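(* Let $n$ be an even integer with $8\le n\le20$. If $\mathcal{C}$ is a quantum code of distance $2$ for the $\mathfrak{su}(2)$ quantum metric on the irreducible representation of $\mathfrak{su}(2)$ of dimension $n+1$, then $\dim(\mathcal{C})\le\frac n2-1$.
   Context: The $\mathfrak{su}(2)$ quantum metric: $\mathcal{H}$ is the $(n+1)$-dimensional irreducible unitary representation of $\mathfrak{su}(2)$, $\phi:\mathfrak{su}(2)\to\mathcal{L}(\mathcal{H})$ the action, $\mathcal{E}=\operatorname{span}_{\mathbb{C}}(I_{\mathcal{H}},\phi(\mathfrak{su}(2)))$, $\mathcal{E}_t=\mathbb{C}I_{\mathcal{H}}$ for $0\le t<1$ and $\mathcal{E}_t=\mathcal{E}^{\lfloor t\rfloor}$ (span of products of $\lfloor t\rfloor$ elements of $\mathcal{E}$) for $t\ge1$. A quantum code is a subspace $\mathcal{C}\subseteq\mathcal{H}$ with orthogonal projection $P$; it detects an operator $E$ if $PEP$ is a scalar multiple of $P$; its distance is the largest $d$ such that it detects all $E\in\mathcal{E}_{d-1}$. *)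

theory Defs
  imports "HOL-Analysis.Analysis"
begin

section \<open>Operators on a finite-dimensional Hilbert space\<close>

text \<open>The Hilbert space of dimension \<open>CARD('d)\<close> is \<open>complex^'d\<close> with its standard Hermitian inner
  product, and operators on it are complex square matrices. The inner product enters only through
  the adjoint (conjugate transpose).\<close>

definition dagger :: "complex^'a^'b \<Rightarrow> complex^'b^'a"
  where "dagger A = map_matrix cnj (transpose A)"

text \<open>On matrices \<open>(*s)\<close> is not the multiplication by complex scalars (it would expect a scalar that
  is itself a row), so the complex vector space structure is introduced here.\<close>

definition mat_scale :: "complex \<Rightarrow> complex^'a^'b \<Rightarrow> complex^'a^'b"
  where "mat_scale c A = map_matrix ((*) c) A"

interpretation mat_vs: vector_space "mat_scale :: complex \<Rightarrow> complex^'a^'b \<Rightarrow> complex^'a^'b"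
  by unfold_locales (simp_all add: mat_scale_def vec_eq_iff algebra_simps)

section \<open>Representations of su(2)\<close>

text \<open>The real Lie algebra of traceless skew-Hermitian matrices; the bracket is the commutator.\<close>

definition su2 :: "(complex^2^2) set"
  where "su2 = {X. dagger X = - X \<and> trace X = 0}"

definition commutator :: "complex^'a^'a \<Rightarrow> complex^'a^'a \<Rightarrow> complex^'a^'a"
  where "commutator A B = A ** B - B ** A"

text \<open>Only the values of \<open>\<phi>\<close> on \<open>su2\<close> matter.\<close>

definition su2_rep :: "(complex^2^2 \<Rightarrow> complex^'d^'d) \<Rightarrow> bool"
  where "su2_rep \<phi> \<longleftrightarrow>
    (\<forall>X\<in>su2. \<forall>Y\<in>su2. \<phi> (X + Y) = \<phi> X + \<phi> Y) \<and>
    (\<forall>r::real. \<forall>X\<in>su2. \<phi> (r *\<^sub>R X) = r *\<^sub>R \<phi> X) \<and>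
    (\<forall>X\<in>su2. \<forall>Y\<in>su2. \<phi> (commutator X Y) = commutator (\<phi> X) (\<phi> Y))"

text \<open>Unitarity of a Lie algebra representation: the real Lie algebra acts by skew-Hermitian operators.\<close>

definition unitary_su2_rep :: "(complex^2^2 \<Rightarrow> complex^'d^'d) \<Rightarrow> bool"
  where "unitary_su2_rep \<phi> \<longleftrightarrow> su2_rep \<phi> \<and> (\<forall>X\<in>su2. dagger (\<phi> X) = - \<phi> X)"

text \<open>The representation space \<open>complex^'d\<close> is never zero, so this need not be required.\<close>

definition irreducible_su2_rep :: "(complex^2^2 \<Rightarrow> complex^'d^'d) \<Rightarrow> bool"
  where "irreducible_su2_rep \<phi> \<longleftrightarrow> su2_rep \<phi> \<and>
    (\<forall>V. vec.subspace V \<and> (\<forall>X\<in>su2. \<forall>v\<in>V. \<phi> X *v v \<in> V) \<longrightarrow> V = {0} \<or> V = UNIV)"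

section \<open>The su(2) quantum metric\<close>

definition op_power :: "(complex^'d^'d) set \<Rightarrow> nat \<Rightarrow> (complex^'d^'d) set"
  where "op_power S k = mat_vs.span {foldr (**) As (mat 1) |As. length As = k \<and> set As \<subseteq> S}"

definition su2_error_space :: "(complex^2^2 \<Rightarrow> complex^'d^'d) \<Rightarrow> (complex^'d^'d) set"
  where "su2_error_space \<phi> = mat_vs.span (insert (mat 1) (\<phi> ` su2))"

text \<open>Only the values at \<open>t \<ge> 0\<close> are meaningful.\<close>

definition su2_metric :: "(complex^2^2 \<Rightarrow> complex^'d^'d) \<Rightarrow> real \<Rightarrow> (complex^'d^'d) set"
  where "su2_metric \<phi> t =
    (if t < 1 then mat_vs.span {mat 1} else op_power (su2_error_space \<phi>) (nat \<lfloor>t\<rfloor>))"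

section \<open>Quantum codes\<close>

definition is_orth_proj :: "(complex^'d) set \<Rightarrow> complex^'d^'d \<Rightarrow> bool"
  where "is_orth_proj C P \<longleftrightarrow> P ** P = P \<and> dagger P = P \<and> range ((*v) P) = C"

definition orth_proj :: "(complex^'d) set \<Rightarrow> complex^'d^'d"
  where "orth_proj C = (THE P. is_orth_proj C P)"

definition detects :: "(complex^'d) set \<Rightarrow> complex^'d^'d \<Rightarrow> bool"
  where "detects C E \<longleftrightarrow>
    (\<exists>c. orth_proj C ** E ** orth_proj C = mat_scale c (orth_proj C))"

definition detects_up_to :: "(real \<Rightarrow> (complex^'d^'d) set) \<Rightarrow> (complex^'d) set \<Rightarrow> nat \<Rightarrow> bool"
  where "detects_up_to \<E> C d \<longleftrightarrow> d \<ge> 1 \<and> (\<forall>E \<in> \<E> (real d - 1). detects C E)"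

text \<open>The distance is a relation rather than a function because there need not be a largest \<open>d\<close>:
  codes of dimension at most 1 detect every operator. It ranges over positive integers because
  \<open>\<E>\<close> is constant on the intervals \<open>[k, k + 1)\<close>, so over the reals a supremum would not be attained.\<close>

definition code_distance :: "(real \<Rightarrow> (complex^'d^'d) set) \<Rightarrow> (complex^'d) set \<Rightarrow> nat \<Rightarrow> bool"
  where "code_distance \<E> C d \<longleftrightarrow>
    detects_up_to \<E> C d \<and> (\<forall>d'. detects_up_to \<E> C d' \<longrightarrow> d' \<le> d)"

section \<open>Existence and uniqueness of the orthogonal projection\<close>

lemma dagger_dagger: "dagger (dagger A) = A"
  by (simp add: dagger_def vec_eq_iff transpose_def)

lemma dagger_mult: "dagger (A ** B) = dagger B ** dagger A"
  by (simp add: dagger_def vec_eq_iff transpose_def matrix_matrix_mult_def mult.commute)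

lemma inner_dagger: "(A *v x) \<bullet> y = x \<bullet> (dagger A *v y)"
proof -
  have "(A *v x) \<bullet> y = (\<Sum>i\<in>UNIV. \<Sum>j\<in>UNIV. (A$i$j * x$j) \<bullet> (y$i))"
    by (simp add: inner_vec_def matrix_vector_mult_def inner_sum_left)
  also have "\<dots> = (\<Sum>j\<in>UNIV. \<Sum>i\<in>UNIV. (A$i$j * x$j) \<bullet> (y$i))"
    by (rule sum.swap)
  also have "\<dots> = (\<Sum>j\<in>UNIV. \<Sum>i\<in>UNIV. (x$j) \<bullet> (cnj (A$i$j) * y$i))"
    by (intro sum.cong refl) (simp add: inner_complex_def algebra_simps)
  also have "\<dots> = x \<bullet> (dagger A *v y)"
    by (simp add: inner_vec_def matrix_vector_mult_def dagger_def transpose_def inner_sum_right)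
  finally show ?thesis .
qed

lemma inner_smult: "(a *s x) \<bullet> y = x \<bullet> (cnj a *s y)" for x y :: "complex^'d"
  by (simp add: inner_vec_def inner_complex_def algebra_simps)

lemma is_orth_proj_unique:
  assumes "is_orth_proj C P" "is_orth_proj C Q"
  shows "P = Q"
proof -
  have fix_range: "R ** S = S" if "is_orth_proj C R" "is_orth_proj C S" for R S
  proof -
    have "R *v (S *v x) = S *v x" for x
    proof -
      have "S *v x \<in> range ((*v) R)"
        using that by (auto simp: is_orth_proj_def)
      then obtain z where "S *v x = R *v z" by auto
      then show ?thesis
        using that(1) by (simp add: matrix_vector_mul_assoc is_orth_proj_def)
    qed
    then show ?thesis
      by (simp add: matrix_eq matrix_vector_mul_assoc[symmetric])
  qed
  have "Q = dagger (P ** Q)"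
    using fix_range[OF assms] assms(2) by (simp add: is_orth_proj_def)
  also have "\<dots> = Q ** P"
    using assms by (simp add: dagger_mult is_orth_proj_def)
  also have "\<dots> = P"
    using fix_range[OF assms(2,1)] .
  finally show ?thesis by simp
qed

lemma is_orth_proj_exists:
  fixes C :: "(complex^'d) set"
  assumes C: "vec.subspace C"
  shows "\<exists>P. is_orth_proj C P"
proof -
  have scaleR_smult: "r *\<^sub>R x = complex_of_real r *s x" for r and x :: "complex^'d"
    unfolding vec_eq_iff vector_scaleR_component vector_smult_component by (simp only: scaleR_conv_of_real simp_thms)
  have "subspace C"
    using C by (auto simp: subspace_def vec.subspace_def scaleR_smult)
  then have "\<exists>y\<in>C. \<forall>w\<in>C. (x - y) \<bullet> w = 0" for x
    by (metis orthogonal_subspace_decomp_exists[of C x] span_eq_iff orthogonal_def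
        add_diff_cancel_left')
  then obtain p where pC: "p x \<in> C" and p0: "w \<in> C \<Longrightarrow> (x - p x) \<bullet> w = 0" for x w
    by metis
  have p_eq: "p x = y" if "y \<in> C" "\<And>w. w \<in> C \<Longrightarrow> (x - y) \<bullet> w = 0" for x y
  proof -
    have mem: "p x - y \<in> C"
      using C pC that(1) by (simp add: vec.subspace_diff)
    have "(p x - y) \<bullet> (p x - y) = (x - y) \<bullet> (p x - y) - (x - p x) \<bullet> (p x - y)"
      by (simp add: inner_diff_left)
    also have "\<dots> = 0"
      using mem p0 that(2) by simp
    finally show ?thesis by simp
  qed
  have p_add: "p (x + y) = p x + p y" for x y
  proof (rule p_eq)
    show "p x + p y \<in> C" using C pC by (simp add: vec.subspace_add)
    fix w assume "w \<in> C"
    then show "(x + y - (p x + p y)) \<bullet> w = 0"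
      using p0[of w x] p0[of w y] by (simp add: inner_diff_left inner_add_left)
  qed
  have p_smult: "p (a *s x) = a *s p x" for a x
  proof (rule p_eq)
    show "a *s p x \<in> C" using C pC by (simp add: vec.subspace_scale)
    fix w assume "w \<in> C"
    then have "(x - p x) \<bullet> (cnj a *s w) = 0"
      using C by (intro p0) (simp add: vec.subspace_scale)
    then show "(a *s x - a *s p x) \<bullet> w = 0"
      by (metis inner_smult vec.scale_right_diff_distrib)
  qed
  have "Vector_Spaces.linear (*s) (*s) p"
    by unfold_locales (simp_all add: p_add p_smult)
  then have P: "matrix p *v x = p x" for x
    by (rule matrix_works)
  have p_id: "p x = x" if "x \<in> C" for x
    by (rule p_eq) (use that in auto)
  have sa: "p x \<bullet> y = x \<bullet> p y" for x y
    using p0[OF pC, of x y] p0[OF pC, of y x] by (simp add: inner_diff_left inner_diff_right inner_commute)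
  have "matrix p ** matrix p = matrix p"
    by (simp add: matrix_eq matrix_vector_mul_assoc[symmetric] P p_id pC)
  moreover have "dagger (matrix p) *v y = matrix p *v y" for y
  proof -
    have "x \<bullet> (dagger (matrix p) *v y) = x \<bullet> (matrix p *v y)" for x
      by (simp add: inner_dagger[symmetric] P sa)
    then show ?thesis by (metis vector_eq_ldot)
  qed
  then have "dagger (matrix p) = matrix p"
    by (simp add: matrix_eq)
  moreover have "range ((*v) (matrix p)) = C"
    using pC p_id by (auto simp: P image_iff) metis
  ultimately show ?thesis
    unfolding is_orth_proj_def by blast
qed

lemma orth_proj:
  assumes "vec.subspace C"
  shows "is_orth_proj C (orth_proj C)"
  unfolding orth_proj_def
  using is_orth_proj_exists[OF assms] is_orth_proj_unique by (rule_tac theI') blast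

end

theory Submission
  imports Defs "HOL-Analysis.Cross3" "HOL-Computational_Algebra.Polynomial"
begin

text \<open>Suppose the code has dimension at least \<open>K = n / 2\<close>, and let \<open>P\<close> project onto a subspace of
  dimension \<open>K\<close>. Expand \<open>P\<close> into spherical tensors of rank \<open>0, \<dots>, n\<close>. Detection of the spin
  operators determines the expectation of the adjoint Casimir operator in \<open>P\<close>, and its value is so
  large that \<open>P\<close> can only have components of rank \<open>0\<close> and \<open>n\<close>. In a weight basis the component of
  rank \<open>n\<close> is, up to diagonal scaling, a Hankel matrix, i.e. a linear functional \<open>\<ell>\<close> on
  polynomials of degree at most \<open>2 n\<close>, and \<open>P\<^sup>2 = P\<close> becomes \<open>\<ell>\<^sub>x \<ell>\<^sub>y ((x - y)\<^sup>n p(x) q(y)) = \<nu>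
  \<ell>(p q) + \<beta> \<langle>p, q\<rangle>\<close> with the invariant pairing \<open>\<langle>p, q\<rangle>\<close> and \<open>\<beta> \<noteq> 0\<close>. Applying \<open>\<ell>\<^sub>x \<ell>\<^sub>y \<ell>\<^sub>z\<close> to a
  suitable polynomial that is divisible by \<open>(x - y)\<^sup>n\<close> and has vanishing cyclic sum over \<open>x, y, z\<close>
  gives \<open>\<ell>((1 + u z)\<^sup>2\<^sup>n) = 0\<close> for all \<open>u\<close>. Hence \<open>\<ell> = 0\<close>, contradicting \<open>\<beta> \<noteq> 0\<close>.\<close>

section \<open>Functionals on polynomials and the invariant pairing\<close>

text \<open>Representing a functional by weights on nodes turns its tensor powers into finite sums over
  tuples of nodes.\<close>

lemma moments_of_nodes:
  fixes h :: "nat \<Rightarrow> complex"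
  shows "\<exists>w. \<forall>q\<le>d. h q = (\<Sum>s\<le>d. w s * of_nat s ^ q)"
proof -
  \<comment> \<open>Lagrange basis polynomials at the nodes 0, ..., d. The weight of a node is the
    functional applied to its basis polynomial.\<close>
  define L where "L s = (\<Prod>r\<in>{..d}-{s}. smult (1
      / (of_nat s - of_nat r)) [:- of_nat r, 1 :: complex:])" for s
  have L: "poly (L s) (of_nat r) = (if r = s then 1 else 0)" if "r \<le> d" for r s
  proof (cases "r = s")
    case True
    have "poly (smult (1 / (of_nat s - of_nat q)) [:- of_nat q, 1 :: complex:]) (of_nat s) = 1"
        if "q \<noteq> s" for q
      using that by (simp add: divide_simps)
    then show ?thesis using True by (simp add: L_def poly_prod)
  qed (use that in \<open>auto simp: L_def poly_prod prod_zero_iff\<close>)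
  have degL: "degree (L s) \<le> d" if "s \<le> d" for s
  proof -
    have "degree (L s) \<le> (\<Sum>r\<in>{..d}-{s}. 1)"
      unfolding L_def
      by (rule order.trans[OF degree_prod_sum_le])
          (auto intro!: sum_mono order.trans[OF degree_smult_le])
    then show ?thesis using that by simp
  qed
  have mon: "monom 1 q = (\<Sum>s\<le>d. smult (of_nat s ^ q) (L s))" if "q \<le> d" for q
  proof (rule poly_eqI_degree[where A = "of_nat ` {..d}"])
    fix x :: complex assume "x \<in> of_nat ` {..d}"
    then obtain r where r: "r \<le> d" "x = of_nat r" by auto
    show "poly (monom 1 q) x = poly (\<Sum>s\<le>d. smult (of_nat s ^ q) (L s)) x"
      using r by (simp add: poly_sum L poly_monom if_distrib cong: if_cong)
  next
    have card: "card ((of_nat :: nat \<Rightarrow> complex) ` {..d}) = Suc d"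
      by (simp add: card_image)
    show "degree (monom (1::complex) q) < card ((of_nat :: nat \<Rightarrow> complex) ` {..d})"
      using that degree_monom_le[of "1::complex" q] by (simp only: card)
    have "degree (\<Sum>s\<le>d. smult (of_nat s ^ q) (L s)) \<le> d"
      by (intro degree_sum_le) (auto intro: order.trans[OF degree_smult_le] degL)
    then show "degree (\<Sum>s\<le>d. smult (of_nat s ^ q) (L s)) < card ((of_nat :: nat \<Rightarrow> complex) ` {..d})"
      by (simp only: card)
  qed
  define w where "w s = (\<Sum>i\<le>d. h i * coeff (L s) i)" for s
  have "h q = (\<Sum>s\<le>d. w s * of_nat s ^ q)" if "q \<le> d" for q
  proof -
    have "(\<Sum>s\<le>d. w s * of_nat s ^ q) = (\<Sum>i\<le>d. h i * (\<Sum>s\<le>d. coeff (L s) i * of_nat s ^ q))"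
      unfolding w_def sum_distrib_left sum_distrib_right by (subst sum.swap) (simp add: mult_ac)
    also have "\<dots> = (\<Sum>i\<le>d. h i * coeff (monom 1 q) i)"
      using that by (simp add: mon coeff_sum mult.commute)
    also have "\<dots> = h q"
      using that by (simp add: if_distrib cong: if_cong)
    finally show ?thesis by simp
  qed
  then show ?thesis by blast
qed

text \<open>The invariant bilinear form on polynomials of degree at most \<open>n\<close>, i.e. on the irreducible
  representation of dimension \<open>n + 1\<close>.\<close>

definition apolar :: "nat \<Rightarrow> complex poly \<Rightarrow> complex poly \<Rightarrow> complex"
  where "apolar n p q = (\<Sum>i\<le>n. (-1)^i / of_nat (n choose i) * coeff p i * coeff q (n - i))"

lemma apolar_sum_right: "apolar n p (\<Sum>b\<in>B. smult (c b) (q b)) = (\<Sum>b\<in>B. c b * apolar n p (q b))"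
  unfolding apolar_def coeff_sum sum_distrib_left by (subst sum.swap) (simp add: mult_ac)

lemma coeff_linear_power:
  fixes v :: complex
  assumes "i \<le> n"
  shows "coeff ([:- v, 1:] ^ n) i = of_nat (n choose i) * (- v) ^ (n - i)"
proof -
  have "[:- v, 1:] ^ n = (monom 1 1 + [:- v:]) ^ n"
    by (simp add: monom_altdef)
  also have "\<dots> = (\<Sum>k\<le>n. monom (of_nat (n choose k) * (- v) ^ (n - k)) k)"
    by (subst binomial_ring)
      (auto intro!: sum.cong simp: monom_power of_nat_monom mult_monom monom_0[symmetric] simp
          del: monom_0)
  finally show ?thesis using assms by (simp add: coeff_sum)
qed

text \<open>The weights of \<open>apolar\<close> cancel the binomial coefficients and the signs in
  (x - v)^n, so this power represents evaluation at v.\<close>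

lemma apolar_reproducing:
  assumes "degree p \<le> n"
  shows "apolar n p ([:- v, 1:] ^ n) = poly p v"
proof -
  have "apolar n p ([:- v, 1:] ^ n) = (\<Sum>i\<le>n. coeff p i * v ^ i)"
    unfolding apolar_def
  proof (rule sum.cong)
    fix i assume "i \<in> {..n}"
    then have i: "i \<le> n" by simp
    then have "(n choose (n - i)) = (n choose i)" "(n choose i) \<noteq> 0"
      using binomial_symmetric[of i n] by auto
    then show "(-1)^i / of_nat (n choose i) * coeff p i * coeff ([:- v, 1:] ^ n) (n - i)
        = coeff p i * v ^ i"
      using i by (subst coeff_linear_power) (auto simp: power_minus[of v])
  qed simp
  also have "\<dots> = poly p v"
    unfolding poly_altdef using assms
    by (intro sum.mono_neutral_right) (auto simp: coeff_eq_0)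
  finally show ?thesis .
qed


text \<open>Covariance of the pairing under x -> (x - z) / (1 + u x), a substitution of determinant
  1 + u z: transformed monomials pair like monomials, up to the nth power of the determinant. The
  generating function of the pairings is the pairing with a power of one linear form, which
  \<open>apolar_reproducing\<close> evaluates.\<close>

lemma apolar_moebius:
  fixes z u :: complex
  assumes "a \<le> n"
  shows "apolar n ([:- z, 1:] ^ a * [:1, u:] ^ (n - a)) ([:- z, 1:] ^ (n - a) * [:1, u:] ^ a)
    = (-1) ^ a * (1 + u * z) ^ n / of_nat (n choose a)"
proof -
  define p where "p = [:- z, 1:] ^ a * [:1, u:] ^ (n - a)"
  define A where "A b = apolar n p ([:- z, 1:] ^ b * [:1, u:] ^ (n - b))" for b
  have degp: "degree p \<le> n"
    unfolding p_def using assms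
    by (intro order.trans[OF degree_mult_le]
        order.trans[OF add_mono[OF degree_power_le degree_power_le]]) auto
  have eq: "(\<Sum>b\<le>n. of_nat (n choose b) * (- t) ^ (n - b) * A b) = (1 + u * z) ^ n * t ^ a"
    if t: "t * u \<noteq> 1" for t
  proof -
    \<comment> \<open>v is the root of the linear form (x - z) - t (1 + u x), whose leading
      coefficient is 1 - t u.\<close>
    define v where "v = (t + z) / (1 - t * u)"
    have v: "v * (1 - t * u) = t + z"
      using t by (simp add: v_def)
    have "(\<xi> + smult c \<eta>) ^ n
        = (\<Sum>b\<le>n. smult (of_nat (n choose b) * c ^ (n - b)) (\<xi> ^ b * \<eta> ^ (n - b)))"
      for \<xi> \<eta> :: "complex poly" and c
      by (subst binomial_ring) (auto intro!: sum.cong simp: smult_power of_nat_poly mult_ac)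
    from this[of "[:- z, 1:]" "- t" "[:1, u:]"] have "(\<Sum>b\<le>n. of_nat (n choose b) * (- t) ^ (n - b)
        * A b)
        = apolar n p (([:- z, 1:] + smult (- t) [:1, u:]) ^ n)"
      by (simp only: A_def apolar_sum_right mult.assoc)
    also have "[:- z, 1:] + smult (- t) [:1, u:] = smult (1 - t * u) [:- v, 1:]"
      using v by (simp add: algebra_simps)
    also have "apolar n p (\<dots> ^ n) = (1 - t * u) ^ n * poly p v"
      using apolar_sum_right[of n p "\<lambda>_. (1 - t * u) ^ n" "\<lambda>_. [:- v, 1:] ^ n" "{0::nat}"]
        apolar_reproducing[OF degp, of v]
      by (simp add: smult_power[symmetric] del: smult_pCons)
    also have "\<dots> = (1 - t * u) ^ (a + (n - a)) * poly p v"
      using assms by simp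
    also have "\<dots> = (v * (1 - t * u) - z * (1 - t * u)) ^ a
        * ((1 - t * u) + u * (v * (1 - t * u))) ^ (n - a)"
      by (simp add: p_def poly_power power_add flip: power_mult_distrib)
          (simp add: algebra_simps flip: power_mult_distrib)
    also have "\<dots> = (t * (1 + u * z)) ^ a * (1 + u * z) ^ (n - a)"
      unfolding v by (simp add: algebra_simps)
    also have "\<dots> = (1 + u * z) ^ (a + (n - a)) * t ^ a"
      unfolding power_add by (simp add: power_mult_distrib mult_ac)
    finally show ?thesis using assms by simp
  qed
  \<comment> \<open>The identity \<open>eq\<close> holds for all but at most one t, so it is an
    identity of polynomials in t; only b = n - a contributes to the coefficient of t^a. For u = 0
    the excluded point 1 / u is 0 by convention, and infinitely many t remain.\<close>
  define Q where "Q = (\<Sum>b\<le>n. monom (of_nat (n choose b) * (- 1) ^ (n - b) * A b) (n - b))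
      - monom ((1 + u * z) ^ n) a"
  have "poly Q t = 0" if "t \<notin> {1 / u}" for t
  proof -
    have "t * u \<noteq> 1"
      using that by (metis eq_divide_imp mult_zero_right singletonI zero_neq_one)
    from eq[OF this] show ?thesis
      by (simp add: Q_def poly_sum poly_monom power_minus[of t] mult_ac)
  qed
  then have "- {1 / u} \<subseteq> {t. poly Q t = 0}" by blast
  moreover have "infinite (- {1 / u})"
    by (simp add: infinite_UNIV_char_0 Compl_eq_Diff_UNIV)
  ultimately have "Q = 0"
    using poly_roots_finite infinite_super by blast
  then have "0 = coeff Q a" by simp
  also have "\<dots> = (\<Sum>b\<le>n. coeff (monom (of_nat (n choose b) * (- 1) ^ (n - b) * A b) (n - b)) a)
      - (1 + u * z) ^ n"
    by (simp add: Q_def coeff_sum)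
  also have "(\<Sum>b\<le>n. coeff (monom (of_nat (n choose b) * (- 1) ^ (n - b) * A b) (n - b)) a)
      = (\<Sum>b\<in>{n - a}. of_nat (n choose b) * (- 1) ^ (n - b) * A b)"
    by (rule sum.mono_neutral_cong_right) (use assms in auto)
  also have "\<dots> = of_nat (n choose a) * (- 1) ^ a * A (n - a)"
    using assms by (simp add: binomial_symmetric[of a n])
  finally have "of_nat (n choose a) * (- 1) ^ a * A (n - a) = (1 + u * z) ^ n" by simp
  moreover have "(- 1) ^ a * (- 1) ^ a = (1 :: complex)"
    by (simp flip: power_add)
  ultimately have "of_nat (n choose a) * A (n - a) = (- 1) ^ a * (1 + u * z) ^ n"
    by (metis mult.assoc mult.commute mult_1)
  then show ?thesis
    using assms by (simp add: A_def p_def field_simps)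
qed

text \<open>The pairing in \<open>x\<close> and \<open>y\<close> of the transvectant \<open>(x - y)\<^bsup>n - 2m\<^esup> (y - z)\<^sup>m (z - x)\<^sup>m\<close> for
  even \<open>n\<close>; it does not depend on \<open>z\<close>.\<close>

definition transvection_coeff :: "nat \<Rightarrow> nat \<Rightarrow> complex"
  where "transvection_coeff n m = (\<Sum>k\<le>n - 2 * m. of_nat ((n - 2 * m) choose k)
      / of_nat (n choose (m + k)))"

section \<open>The tensor square of the functional, evaluated at nodes\<close>

lemma sum_rotate3:
  "(\<Sum>s\<in>A. \<Sum>r\<in>B. \<Sum>l\<in>C. f s r l) = (\<Sum>l\<in>C. \<Sum>s\<in>A. \<Sum>r\<in>B. f s r l)"
  for f :: "'a \<Rightarrow> 'b \<Rightarrow> 'c \<Rightarrow> 'd :: comm_monoid_add"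
proof -
  have "(\<Sum>s\<in>A. \<Sum>r\<in>B. \<Sum>l\<in>C. f s r l) = (\<Sum>s\<in>A. \<Sum>l\<in>C. \<Sum>r\<in>B. f s r l)"
    by (rule sum.cong[OF refl sum.swap])
  also have "\<dots> = (\<Sum>l\<in>C. \<Sum>s\<in>A. \<Sum>r\<in>B. f s r l)"
    by (rule sum.swap)
  finally show ?thesis .
qed

text \<open>The hypothesis \<open>E\<close> is the claim for p = x^i and q = x^k: the binomial
  expansion of (x - y)^n turns the sum over pairs of nodes into products of moments, with indices at
  most 2 n, where the nodes represent \<open>h\<close>. Bilinearity gives the general case.\<close>

lemma bilinear_nodes:
  fixes h w :: "nat \<Rightarrow> complex"
  assumes h: "\<And>q. q \<le> 2 * n \<Longrightarrow> h q = (\<Sum>s\<le>2 * n. w s * of_nat s ^ q)"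
    and E: "\<And>i k. i \<le> n \<Longrightarrow> k \<le> n \<Longrightarrow>
      (\<Sum>l\<le>n. (-1)^l * of_nat (n choose l) * h (i + n - l) * h (l + k))
        = \<nu> * h (i + k) + (if i + k = n then \<beta> * (-1)^i / of_nat (n choose i) else 0)"
    and p: "degree p \<le> n" and q: "degree q \<le> n"
  shows "(\<Sum>s\<le>2 * n. \<Sum>r\<le>2 * n. w s * w r
      * ((of_nat s - of_nat r) ^ n * poly p (of_nat s) * poly q (of_nat r)))
    = \<nu> * (\<Sum>s\<le>2 * n. w s * poly p (of_nat s) * poly q (of_nat s)) + \<beta> * apolar n p q"
proof -
  let ?N = "{..2 * n}"
  have alt: "poly p x = (\<Sum>i\<le>n. coeff p i * x ^ i)" if "degree p \<le> n" for p and x :: complex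
    unfolding poly_altdef using that by (intro sum.mono_neutral_left) (auto simp: coeff_eq_0)
  have mono: "(\<Sum>s\<in>?N. \<Sum>r\<in>?N. w s * w r * ((of_nat s - of_nat r) ^ n * of_nat s ^ i * of_nat r ^ k))
      = \<nu> * h (i + k) + (if i + k = n then \<beta> * (-1)^i / of_nat (n choose i) else 0)"
    if "i \<le> n" "k \<le> n" for i k
  proof -
    have "(of_nat s - of_nat r) ^ n = (\<Sum>l\<le>n. of_nat (n choose l) * (- of_nat r) ^ l
        * of_nat s ^ (n - l) :: complex)" for s r
      using binomial_ring[of "- of_nat r" "of_nat s :: complex" n] by simp
    then have "(\<Sum>s\<in>?N. \<Sum>r\<in>?N. w s * w r * ((of_nat s - of_nat r) ^ n * of_nat s ^ i * of_nat r ^ k))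
       = (\<Sum>s\<in>?N. \<Sum>r\<in>?N. \<Sum>l\<le>n. (-1)^l * of_nat (n choose l)
           * ((w s * (of_nat s ^ (n - l) * of_nat s ^ i)) * (w r * of_nat r ^ (l + k))))"
      by (simp add: sum_distrib_left sum_distrib_right power_add power_minus[of "of_nat _"] mult_ac)
    also have "\<dots> = (\<Sum>l\<le>n. \<Sum>s\<in>?N. \<Sum>r\<in>?N. (-1)^l * of_nat (n choose l)
        * ((w s * (of_nat s ^ (n - l) * of_nat s ^ i)) * (w r * of_nat r ^ (l + k))))"
      by (rule sum_rotate3)
    also have "\<dots> = (\<Sum>l\<le>n. (-1)^l * of_nat (n choose l) * h (i + n - l) * h (l + k))"
    proof (rule sum.cong)
      fix l assume "l \<in> {..n}"
      then have l: "n - l + i = i + n - l" "i + n - l \<le> 2 * n" "l + k \<le> 2 * n"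
        using that by auto
      have "x ^ (n - l) * x ^ i = x ^ (i + n - l)" for x :: complex
        by (simp add: l(1) flip: power_add)
      with l show "(\<Sum>s\<in>?N. \<Sum>r\<in>?N. (-1)^l * of_nat (n choose l)
          * ((w s * (of_nat s ^ (n - l) * of_nat s ^ i)) * (w r * of_nat r ^ (l + k))))
          = (-1)^l * of_nat (n choose l) * h (i + n - l) * h (l + k)"
        by (simp add: l h sum_product mult.assoc flip: sum_distrib_left)
    qed simp
    finally show ?thesis using E[OF that] by simp
  qed
  have "(\<Sum>s\<in>?N. \<Sum>r\<in>?N. w s * w r * ((of_nat s - of_nat r) ^ n * poly p (of_nat s)
      * poly q (of_nat r)))
     = (\<Sum>s\<in>?N. \<Sum>r\<in>?N. \<Sum>i\<le>n. \<Sum>k\<le>n. coeff p i * coeff q k *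
         (w s * w r * ((of_nat s - of_nat r) ^ n * of_nat s ^ i * of_nat r ^ k)))"
    by (simp add: alt p q sum_product) (simp add: sum_distrib_left mult_ac)
  also have "\<dots> = (\<Sum>i\<le>n. \<Sum>k\<le>n. \<Sum>s\<in>?N. \<Sum>r\<in>?N. coeff p i * coeff q k *
         (w s * w r * ((of_nat s - of_nat r) ^ n * of_nat s ^ i * of_nat r ^ k)))"
    by (subst sum_rotate3) (rule sum.cong[OF refl sum_rotate3])
  also have "\<dots> = (\<Sum>i\<le>n. \<Sum>k\<le>n. coeff p i * coeff q k *
       (\<nu> * h (i + k) + (if i + k = n then \<beta> * (-1)^i / of_nat (n choose i) else 0)))"
    by (simp add: mono flip: sum_distrib_left)
  also have "\<dots> = (\<Sum>i\<le>n. \<Sum>k\<le>n. coeff p i * coeff q k * (\<nu> * h (i + k)))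
      + (\<Sum>i\<le>n. \<Sum>k\<le>n. if k = n - i then coeff p i * coeff q k
          * (\<beta> * (-1)^i / of_nat (n choose i)) else 0)"
    unfolding sum.distrib[symmetric] by (auto intro!: sum.cong simp: algebra_simps)
  also have "(\<Sum>i\<le>n. \<Sum>k\<le>n. coeff p i * coeff q k * (\<nu> * h (i + k)))
      = \<nu> * (\<Sum>i\<le>n. \<Sum>k\<le>n. \<Sum>s\<in>?N. w s * (coeff p i * of_nat s ^ i) * (coeff q k * of_nat s ^ k))"
    by (simp add: h sum_distrib_left power_add mult_ac)
  also have "(\<Sum>i\<le>n. \<Sum>k\<le>n. \<Sum>s\<in>?N. w s * (coeff p i * of_nat s ^ i) * (coeff q k * of_nat s ^ k))
      = (\<Sum>s\<in>?N. \<Sum>i\<le>n. \<Sum>k\<le>n. w s * (coeff p i * of_nat s ^ i) * (coeff q k * of_nat s ^ k))"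
    by (rule sum_rotate3)
  also have "\<dots> = (\<Sum>s\<in>?N. w s * poly p (of_nat s) * poly q (of_nat s))"
    by (simp add: alt p q sum_product mult.assoc)
        (simp add: sum_distrib_left sum_distrib_right mult_ac)
  also have "(\<Sum>i\<le>n. \<Sum>k\<le>n. if k = n - i then coeff p i * coeff q k
      * (\<beta> * (-1)^i / of_nat (n choose i)) else 0)
      = \<beta> * apolar n p q"
    by (simp add: apolar_def sum_distrib_left mult_ac)
  finally show ?thesis .
qed

text \<open>For fixed z, the bracketed form times (1 + u z)^(n - 2 m) is a sum of products of a
  polynomial in x and one in y, and \<open>B\<close> applies to each. On the diagonal x = y the
  products agree up to their coefficients, and the \<nu> terms cancel because 2 m < n. The \<beta>
  terms add up by \<open>apolar_moebius\<close>.\<close>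

lemma transvection_nodes:
  fixes w :: "nat \<Rightarrow> complex" and \<nu> \<beta> z u :: complex
  assumes B: "\<And>p q. degree p \<le> n \<Longrightarrow> degree q \<le> n \<Longrightarrow>
      (\<Sum>s\<le>d. \<Sum>r\<le>d. w s * w r * ((of_nat s - of_nat r) ^ n * poly p (of_nat s) * poly q (of_nat r)))
        = \<nu> * (\<Sum>s\<le>d. w s * poly p (of_nat s) * poly q (of_nat s)) + \<beta> * apolar n p q"
    and "even n" and m: "2 * m < n"
  shows "(\<Sum>s\<le>d. \<Sum>r\<le>d. w s * w r * ((of_nat s - of_nat r) ^ n *
      ((of_nat s - of_nat r) ^ (n - 2 * m) * (of_nat r - z) ^ m * (z - of_nat s) ^ m *
       (1 + u * of_nat s) ^ m * (1 + u * of_nat r) ^ m) * (1 + u * z) ^ (2 * n - 2 * m)))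
    = \<beta> * (1 + u * z) ^ (2 * n) * transvection_coeff n m" (is "?L = _")
proof -
  define P where "P k = [:- z, 1:] ^ (n - m - k) * [:1, u:] ^ (m + k)" for k
  define Q where "Q k = [:- z, 1:] ^ (m + k) * [:1, u:] ^ (n - m - k)" for k
  define c :: "nat \<Rightarrow> complex" where "c k = (-1) ^ m * (-1) ^ k * of_nat ((n - 2 * m) choose k)"
      for k
  have degs: "degree (P k) \<le> n" "degree (Q k) \<le> n" if "k \<le> n - 2 * m" for k
    unfolding P_def Q_def using that m
    by (intro order.trans[OF degree_mult_le]
        order.trans[OF add_mono[OF degree_power_le degree_power_le]]; auto)+
  have G: "(x - y) ^ (n - 2 * m) * (y - z) ^ m * (z - x) ^ m * (1 + u * x) ^ m * (1 + u * y) ^ m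
        * (1 + u * z) ^ (n - 2 * m) = (\<Sum>k\<le>n - 2 * m. c k * (poly (P k) x * poly (Q k) y))" for x y
  proof -
    \<comment> \<open>The three-term relation (x - y)(1 + u z) = (x - z)(1 + u y) - (1 + u x)(y -
      z), expanded by the binomial theorem.\<close>
    have "((x - y) * (1 + u * z)) ^ (n - 2 * m)
        = (- ((1 + u * x) * (y - z)) + (x - z) * (1 + u * y)) ^ (n - 2 * m)"
      by (simp add: algebra_simps)
    also have "\<dots> = (\<Sum>k\<le>n - 2 * m. of_nat ((n - 2 * m) choose k) * (- ((1 + u * x) * (y - z))) ^ k
        * ((x - z) * (1 + u * y)) ^ (n - 2 * m - k))"
      by (rule binomial_ring)
    finally have *: "((x - y) * (1 + u * z)) ^ (n - 2 * m) = \<dots>" .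
    have "(x - y) ^ (n - 2 * m) * (y - z) ^ m * (z - x) ^ m * (1 + u * x) ^ m * (1 + u * y) ^ m
        * (1 + u * z) ^ (n - 2 * m)
      = ((x - y) * (1 + u * z)) ^ (n - 2 * m)
          * ((y - z) ^ m * (- (x - z)) ^ m * (1 + u * x) ^ m * (1 + u * y) ^ m)"
      by (simp add: power_mult_distrib mult_ac)
    also have "\<dots> = (\<Sum>k\<le>n - 2 * m. of_nat ((n - 2 * m) choose k) * (- ((1 + u * x) * (y - z))) ^ k
        * ((x - z) * (1 + u * y)) ^ (n - 2 * m - k)
            * ((y - z) ^ m * (- (x - z)) ^ m * (1 + u * x) ^ m * (1 + u * y) ^ m))"
      unfolding * by (rule sum_distrib_right)
    also have "\<dots> = (\<Sum>k\<le>n - 2 * m. c k * (poly (P k) x * poly (Q k) y))"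
    proof (rule sum.cong)
      fix k assume "k \<in> {..n - 2 * m}"
      then have e: "n - m - k = (n - 2 * m - k) + m" using m by simp
      show "of_nat ((n - 2 * m) choose k) * (- ((1 + u * x) * (y - z))) ^ k
        * ((x - z) * (1 + u * y)) ^ (n - 2 * m - k)
            * ((y - z) ^ m * (- (x - z)) ^ m * (1 + u * x) ^ m * (1 + u * y) ^ m)
        = c k * (poly (P k) x * poly (Q k) y)"
        unfolding c_def P_def Q_def e power_minus[of "(1 + u * x) * (y - z)"] power_minus[of "x
            - z"]
        by (simp add: poly_power power_add power_mult_distrib mult_ac)
    qed simp
    finally show ?thesis .
  qed
  have "?L = (\<Sum>s\<le>d. \<Sum>r\<le>d. (1 + u * z) ^ n * (w s * w r * ((of_nat s - of_nat r) ^ n *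
      (\<Sum>k\<le>n - 2 * m. c k * (poly (P k) (of_nat s) * poly (Q k) (of_nat r))))))"
  proof -
    have "2 * n - 2 * m = n + (n - 2 * m)" using m by simp
    then show ?thesis unfolding G[symmetric] by (simp add: power_add mult_ac)
  qed
  also have "\<dots> = (\<Sum>s\<le>d. \<Sum>r\<le>d. \<Sum>k\<le>n - 2 * m. (1 + u * z) ^ n * c k *
      (w s * w r * ((of_nat s - of_nat r) ^ n * poly (P k) (of_nat s) * poly (Q k) (of_nat r))))"
    by (simp add: sum_distrib_left mult_ac)
  also have "\<dots> = (\<Sum>k\<le>n - 2 * m. \<Sum>s\<le>d. \<Sum>r\<le>d. (1 + u * z) ^ n * c k *
      (w s * w r * ((of_nat s - of_nat r) ^ n * poly (P k) (of_nat s) * poly (Q k) (of_nat r))))"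
    by (rule sum_rotate3)
  also have "\<dots> = (\<Sum>k\<le>n - 2 * m. (1 + u * z) ^ n * c k *
      (\<nu> * (\<Sum>s\<le>d. w s * poly (P k) (of_nat s) * poly (Q k) (of_nat s)) + \<beta> * apolar n (P k) (Q k)))"
    by (simp add: B degs flip: sum_distrib_left)
  also have "\<dots> = (\<Sum>k\<le>n - 2 * m. c k)
      * ((1 + u * z) ^ n * \<nu> * (\<Sum>s\<le>d. w s * (of_nat s - z) ^ n * (1 + u * of_nat s) ^ n))
      + (\<Sum>k\<le>n - 2 * m. (1 + u * z) ^ n * \<beta> * (c k * apolar n (P k) (Q k)))"
    unfolding sum_distrib_right sum.distrib[symmetric]
  proof (rule sum.cong)
    fix k assume k: "k \<in> {..n - 2 * m}"
    have e: "n - m - k + (m + k) = n" "m + k + (n - m - k) = n" using k m by auto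
    have "poly (P k) x * poly (Q k) x = (x - z) ^ (n - m - k + (m + k))
        * (1 + u * x) ^ (m + k + (n - m - k))" for x
      unfolding P_def Q_def power_add by (simp add: poly_power mult_ac)
    then have "poly (P k) x * poly (Q k) x = (x - z) ^ n * (1 + u * x) ^ n" for x
      unfolding e .
    then show "(1 + u * z) ^ n * c k *
      (\<nu> * (\<Sum>s\<le>d. w s * poly (P k) (of_nat s) * poly (Q k) (of_nat s)) + \<beta> * apolar n (P k) (Q k))
      = c k * ((1 + u * z) ^ n * \<nu> * (\<Sum>s\<le>d. w s * (of_nat s - z) ^ n * (1 + u * of_nat s) ^ n))
        + (1 + u * z) ^ n * \<beta> * (c k * apolar n (P k) (Q k))"
      by (simp add: mult.assoc) (simp add: algebra_simps)
  qed simp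
  \<comment> \<open>An alternating sum of binomial coefficients with positive exponent n - 2 m. It
    removes the \<nu> terms, which depend on k only through \<open>c k\<close>.\<close>
  also have "(\<Sum>k\<le>n - 2 * m. c k) = 0"
    using choose_alternating_sum[of "n - 2 * m", where 'a = complex] m
    by (simp add: c_def mult.assoc flip: sum_distrib_left)
  also have "(\<Sum>k\<le>n - 2 * m. (1 + u * z) ^ n * \<beta> * (c k * apolar n (P k) (Q k)))
      = (\<Sum>k\<le>n - 2 * m. (1 + u * z) ^ n * \<beta>
          * ((1 + u * z) ^ n * (of_nat ((n - 2 * m) choose k) / of_nat (n choose (m + k)))))"
  proof (rule sum.cong)
    fix k assume k: "k \<in> {..n - 2 * m}"
    \<comment> \<open>The exponent of \<open>apolar_moebius\<close>. Its sign (-1)^a meets (-1)^m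
      (-1)^k from \<open>c k\<close>, and m + k + a = n is even.\<close>
    define a where "a = n - m - k"
    have a: "a \<le> n" "n - a = m + k" "m + k + a = n" using k m by (auto simp: a_def)
    then have C: "n choose a = n choose (m + k)"
      by (metis binomial_symmetric)
    have "apolar n (P k) (Q k) = (-1) ^ a * (1 + u * z) ^ n / of_nat (n choose (m + k))"
      using apolar_moebius[OF a(1), of z u] unfolding P_def Q_def a_def[symmetric] a(2) C .
    moreover have "(-1) ^ m * (-1) ^ k * (-1) ^ a = (1 :: complex)"
      using \<open>even n\<close> by (simp add: a(3) flip: power_add)
    ultimately show "(1 + u * z) ^ n * \<beta> * (c k * apolar n (P k) (Q k))
        = (1 + u * z) ^ n * \<beta> * ((1 + u * z) ^ n
            * (of_nat ((n - 2 * m) choose k) / of_nat (n choose (m + k))))"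
      by (simp add: c_def field_simps)
  qed simp
  also have "\<dots> = \<beta> * (1 + u * z) ^ (2 * n) * transvection_coeff n m"
    unfolding transvection_coeff_def sum_distrib_left mult_2 power_add by (simp only: mult_ac)
  finally show ?thesis by simp
qed

section \<open>The cubic syzygy\<close>

lemma sum_cyclic3:
  "(\<Sum>x\<in>A. \<Sum>y\<in>A. \<Sum>z\<in>A. f x y z) = (\<Sum>x\<in>A. \<Sum>y\<in>A. \<Sum>z\<in>A. f y z x)"
  for f :: "'a \<Rightarrow> 'a \<Rightarrow> 'a \<Rightarrow> 'b :: comm_monoid_add"
  by (subst sum_rotate3) (rule refl)

text \<open>By the syzygy the three cyclic rotations of \<open>F\<close> add up to zero, while the
  weights are symmetric in x, y, z; hence the weighted sum \<open>?S\<close> of \<open>F\<close> is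
  zero. Summing over x and y first, \<open>transvection_nodes\<close> gives \<beta> times a nonzero
  constant times the functional at (1 + u z)^(2 n).\<close>

lemma hankel_zero:
  fixes h :: "nat \<Rightarrow> complex" and g :: "nat \<Rightarrow> complex"
  assumes E: "\<And>i k. i \<le> n \<Longrightarrow> k \<le> n \<Longrightarrow>
      (\<Sum>l\<le>n. (-1)^l * of_nat (n choose l) * h (i + n - l) * h (l + k))
        = \<nu> * h (i + k) + (if i + k = n then \<beta> * (-1)^i / of_nat (n choose i) else 0)"
    and "even n" and \<beta>: "\<beta> \<noteq> 0" and M: "2 * M < n"
    and syzygy: "\<And>a b c :: complex. a + b + c = 0 \<Longrightarrow>
      (\<Sum>m=1..M. g m * (a * b * c) ^ m
          * (a ^ (2 * n - 3 * m) + b ^ (2 * n - 3 * m) + c ^ (2 * n - 3 * m))) = 0"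
    and nz: "(\<Sum>m=1..M. g m * transvection_coeff n m) \<noteq> 0"
  shows "\<forall>q\<le>2 * n. h q = 0"
proof -
  obtain w where w: "\<And>q. q \<le> 2 * n \<Longrightarrow> h q = (\<Sum>s\<le>2 * n. w s * of_nat s ^ q)"
    using moments_of_nodes[of "2 * n" h] by blast
  let ?N = "{..2 * n}"
  have vanish: "(\<Sum>z\<in>?N. w z * (1 + u * of_nat z) ^ (2 * n)) = 0" for u :: complex
  proof -
    \<comment> \<open>The factor \<open>1 + u z\<close> is the Moebius cocycle; it keeps the cyclic sum of \<open>a\<close> equal to zero.\<close>
    define a where "a x y z = (of_nat x - of_nat y) * (1 + u * of_nat z)" for x y z :: nat
    define F where "F x y z = (\<Sum>m=1..M. g m
        * ((a x y z * a y z x * a z x y) ^ m * a x y z ^ (2 * n - 3 * m)))" for x y z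
    have a0: "a x y z + a y z x + a z x y = 0" for x y z
      by (simp add: a_def algebra_simps)
    have F_cyc: "F x y z + F y z x + F z x y = 0" for x y z
    proof -
      have "F x y z + F y z x + F z x y = (\<Sum>m=1..M. g m * (a x y z * a y z x * a z x y) ^ m *
          (a x y z ^ (2 * n - 3 * m) + a y z x ^ (2 * n - 3 * m) + a z x y ^ (2 * n - 3 * m)))"
        unfolding F_def sum.distrib[symmetric] by (rule sum.cong) (simp_all add: algebra_simps)
      then show ?thesis using syzygy[OF a0] by simp
    qed
    let ?S = "\<Sum>x\<in>?N. \<Sum>y\<in>?N. \<Sum>z\<in>?N. w x * w y * w z * F x y z"
    have "?S + ?S + ?S = (\<Sum>x\<in>?N. \<Sum>y\<in>?N. \<Sum>z\<in>?N. w x * w y * w z * F x y z)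
       + (\<Sum>x\<in>?N. \<Sum>y\<in>?N. \<Sum>z\<in>?N. w x * w y * w z * F y z x)
       + (\<Sum>x\<in>?N. \<Sum>y\<in>?N. \<Sum>z\<in>?N. w x * w y * w z * F z x y)"
      using sum_cyclic3[of "\<lambda>x y z. w x * w y * w z * F x y z" ?N]
        sum_cyclic3[of "\<lambda>x y z. w x * w y * w z * F y z x" ?N]
      by (simp add: mult_ac)
    also have "\<dots> = (\<Sum>x\<in>?N. \<Sum>y\<in>?N. \<Sum>z\<in>?N. w x * w y * w z * (F x y z + F y z x + F z x y))"
      by (simp add: sum.distrib ring_distribs)
    finally have S0: "?S = 0"
      by (simp add: F_cyc)
    \<comment> \<open>The total power of x - y is 2 n - 2 m; a factor (x - y)^n is split off to
      match \<open>transvection_nodes\<close>.\<close>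
    have term_m: "(a x y z * a y z x * a z x y) ^ m * a x y z ^ (2 * n - 3 * m) =
        (of_nat x - of_nat y) ^ n * ((of_nat x - of_nat y) ^ (n - 2 * m)
            * (of_nat y - of_nat z) ^ m * (of_nat z - of_nat x) ^ m *
       (1 + u * of_nat x) ^ m * (1 + u * of_nat y) ^ m) * (1 + u * of_nat z) ^ (2 * n - 2 * m)"
           if "m \<in> {1..M}" for x y z m
    proof -
      have e: "n + (n - 2 * m) = (2 * n - 3 * m) + m" "2 * n - 2 * m = (2 * n - 3 * m) + m"
        using that M by auto
      have "(a x y z * a y z x * a z x y) ^ m * a x y z ^ (2 * n - 3 * m)
        = (of_nat x - of_nat y) ^ (n + (n - 2 * m)) * (of_nat y - of_nat z) ^ m
            * (of_nat z - of_nat x) ^ m *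
       (1 + u * of_nat x) ^ m * (1 + u * of_nat y) ^ m * (1 + u * of_nat z) ^ (2 * n - 2 * m)"
        unfolding e by (simp add: a_def power_mult_distrib power_add mult_ac)
      then show ?thesis by (simp add: power_add mult_ac)
    qed
    have "?S = (\<Sum>x\<in>?N. \<Sum>y\<in>?N. \<Sum>z\<in>?N. \<Sum>m=1..M. w x * w y * w z
        * (g m * ((a x y z * a y z x * a z x y) ^ m * a x y z ^ (2 * n - 3 * m))))"
      by (simp add: F_def sum_distrib_left)
    also have "\<dots> = (\<Sum>x\<in>?N. \<Sum>m=1..M. \<Sum>y\<in>?N. \<Sum>z\<in>?N. w x * w y * w z
        * (g m * ((a x y z * a y z x * a z x y) ^ m * a x y z ^ (2 * n - 3 * m))))"
      by (rule sum.cong[OF refl sum_rotate3])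
    also have "\<dots> = (\<Sum>m=1..M. \<Sum>x\<in>?N. \<Sum>y\<in>?N. \<Sum>z\<in>?N. w x * w y * w z
        * (g m * ((a x y z * a y z x * a z x y) ^ m * a x y z ^ (2 * n - 3 * m))))"
      by (rule sum.swap)
    also have "\<dots> = (\<Sum>m=1..M. \<Sum>z\<in>?N. \<Sum>x\<in>?N. \<Sum>y\<in>?N. w x * w y * w z
        * (g m * ((a x y z * a y z x * a z x y) ^ m * a x y z ^ (2 * n - 3 * m))))"
      by (rule sum.cong[OF refl sum_rotate3])
    also have "\<dots> = (\<Sum>m=1..M. \<Sum>z\<in>?N. g m * w z
        * (\<beta> * (1 + u * of_nat z) ^ (2 * n) * transvection_coeff n m))"
    proof (intro sum.cong refl)
      fix m z assume m: "m \<in> {1..M}"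
      then have "2 * m < n" using M by simp
      from transvection_nodes[where z = "of_nat z" and u = u and w = w and d = "2 * n",
          OF bilinear_nodes[OF w E] \<open>even n\<close> this]
      have *: "(\<Sum>s\<in>?N. \<Sum>r\<in>?N. w s * w r
          * ((a s r z * a r z s * a z s r) ^ m * a s r z ^ (2 * n - 3 * m)))
        = \<beta> * (1 + u * of_nat z) ^ (2 * n) * transvection_coeff n m"
        unfolding term_m[OF m] .
      show "(\<Sum>x\<in>?N. \<Sum>y\<in>?N. w x * w y * w z
          * (g m * ((a x y z * a y z x * a z x y) ^ m * a x y z ^ (2 * n - 3 * m))))
         = g m * w z * (\<beta> * (1 + u * of_nat z) ^ (2 * n) * transvection_coeff n m)"
        unfolding *[symmetric] by (simp add: sum_distrib_left mult_ac)
    qed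
    also have "\<dots> = \<beta> * (\<Sum>m=1..M. g m * transvection_coeff n m)
        * (\<Sum>z\<in>?N. w z * (1 + u * of_nat z) ^ (2 * n))"
      unfolding mult.assoc sum_product by (simp add: sum_distrib_left mult_ac)
    finally show ?thesis using S0 \<beta> nz by simp
  qed
  \<comment> \<open>Generating polynomial of the moments: its value at u is the functional applied
    to (1 + u z)^(2 n).\<close>
  define R where "R = (\<Sum>q\<le>2 * n. monom (of_nat ((2 * n) choose q) * h q) q)"
  have "poly R u = 0" for u
  proof -
    have "poly R u = (\<Sum>q\<le>2 * n. \<Sum>z\<in>?N. w z * (of_nat ((2 * n) choose q) * (u * of_nat z) ^ q))"
      by (simp add: R_def poly_sum poly_monom w sum_distrib_left sum_distrib_right
          power_mult_distrib mult_ac)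
    also have "\<dots> = (\<Sum>z\<in>?N. w z * (\<Sum>q\<le>2 * n. of_nat ((2 * n) choose q) * (u * of_nat z) ^ q))"
      by (subst sum.swap) (simp add: sum_distrib_left)
    also have "\<dots> = (\<Sum>z\<in>?N. w z * (1 + u * of_nat z) ^ (2 * n))"
      by (intro sum.cong refl) (use binomial_ring[of "u * of_nat _" 1 "2
          * n"] in \<open>simp add: add.commute\<close>)
    finally show ?thesis using vanish by simp
  qed
  then have "R = 0"
    using poly_all_0_iff_0 by blast
  have "h q = 0" if "q \<le> 2 * n" for q
  proof -
    have "coeff R q = of_nat ((2 * n) choose q) * h q"
      using that by (simp add: R_def coeff_sum)
    then show ?thesis using \<open>R = 0\<close> that by simp
  qed
  then show ?thesis by blast
qed

section \<open>Power sums of three numbers with sum zero\<close>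

text \<open>Here a, b, c are the roots of X^3 + e X - f, which gives the recurrence
  \<open>rec\<close>. The list ends at 37 = 2 * 20 - 3, the largest exponent in a syzygy for n at
  most 20.\<close>

lemma power_sums_sum_zero:
  fixes a b c e f :: complex
  assumes "a + b + c = 0"
    and e_def: "e = a * b + b * c + c * a" and f_def: "f = a * b * c"
  defines "p \<equiv> \<lambda>k. a ^ k + b ^ k + c ^ k"
  shows
    "p 2 = - 2 * e"
    "p 3 = 3 * f"
    "p 4 = 2 * e^2"
    "p 5 = - 5 * e * f"
    "p 6 = - 2 * e^3 + 3 * f^2"
    "p 7 = 7 * e^2 * f"
    "p 8 = 2 * e^4 - 8 * e * f^2"
    "p 9 = - 9 * e^3 * f + 3 * f^3"
    "p 10 = - 2 * e^5 + 15 * e^2 * f^2"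
    "p 11 = 11 * e^4 * f - 11 * e * f^3"
    "p 12 = 2 * e^6 - 24 * e^3 * f^2 + 3 * f^4"
    "p 13 = - 13 * e^5 * f + 26 * e^2 * f^3"
    "p 14 = - 2 * e^7 + 35 * e^4 * f^2 - 14 * e * f^4"
    "p 15 = 15 * e^6 * f - 50 * e^3 * f^3 + 3 * f^5"
    "p 16 = 2 * e^8 - 48 * e^5 * f^2 + 40 * e^2 * f^4"
    "p 17 = - 17 * e^7 * f + 85 * e^4 * f^3 - 17 * e * f^5"
    "p 18 = - 2 * e^9 + 63 * e^6 * f^2 - 90 * e^3 * f^4 + 3 * f^6"
    "p 19 = 19 * e^8 * f - 133 * e^5 * f^3 + 57 * e^2 * f^5"
    "p 20 = 2 * e^10 - 80 * e^7 * f^2 + 175 * e^4 * f^4 - 20 * e * f^6"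
    "p 21 = - 21 * e^9 * f + 196 * e^6 * f^3 - 147 * e^3 * f^5 + 3 * f^7"
    "p 22 = - 2 * e^11 + 99 * e^8 * f^2 - 308 * e^5 * f^4 + 77 * e^2 * f^6"
    "p 23 = 23 * e^10 * f - 276 * e^7 * f^3 + 322 * e^4 * f^5 - 23 * e * f^7"
    "p 24 = 2 * e^12 - 120 * e^9 * f^2 + 504 * e^6 * f^4 - 224 * e^3 * f^6 + 3 * f^8"
    "p 25 = - 25 * e^11 * f + 375 * e^8 * f^3 - 630 * e^5 * f^5 + 100 * e^2 * f^7"
    "p 26 = - 2 * e^13 + 143 * e^10 * f^2 - 780 * e^7 * f^4 + 546 * e^4 * f^6 - 26 * e * f^8"
    "p 27 = 27 * e^12 * f - 495 * e^9 * f^3 + 1134 * e^6 * f^5 - 324 * e^3 * f^7 + 3 * f^9"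
    "p 28 = 2 * e^14 - 168 * e^11 * f^2 + 1155 * e^8 * f^4 - 1176 * e^5 * f^6 + 126 * e^2 * f^8"
    "p 29 = - 29 * e^13 * f + 638 * e^10 * f^3 - 1914 * e^7 * f^5 + 870 * e^4 * f^7 - 29 * e * f^9"
    "p 30 = - 2 * e^15 + 195 * e^12 * f^2 - 1650 * e^9 * f^4 + 2310 * e^6 * f^6 - 450 * e^3 * f^8
        + 3 * f^10"
    "p 31 = 31 * e^14 * f - 806 * e^11 * f^3 + 3069 * e^8 * f^5 - 2046 * e^5 * f^7 + 155 * e^2
        * f^9"
    "p 32 = 2 * e^16 - 224 * e^13 * f^2 + 2288 * e^10 * f^4 - 4224 * e^7 * f^6 + 1320 * e^4 * f^8
        - 32 * e * f^10"
    "p 33 = - 33 * e^15 * f + 1001 * e^12 * f^3 - 4719 * e^9 * f^5 + 4356 * e^6 * f^7 - 605 * e^3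
        * f^9 + 3 * f^11"
    "p 34 = - 2 * e^17 + 255 * e^14 * f^2 - 3094 * e^11 * f^4 + 7293 * e^8 * f^6 - 3366 * e^5
        * f^8 + 187 * e^2 * f^10"
    "p 35 = 35 * e^16 * f - 1225 * e^13 * f^3 + 7007 * e^10 * f^5 - 8580 * e^7 * f^7 + 1925 * e^4
        * f^9 - 35 * e * f^11"
    "p 36 = 2 * e^18 - 288 * e^15 * f^2 + 4095 * e^12 * f^4 - 12012 * e^9 * f^6 + 7722 * e^6 * f^8
        - 792 * e^3 * f^10 + 3 * f^12"
    "p 37 = - 37 * e^17 * f + 1480 * e^14 * f^3 - 10101 * e^11 * f^5 + 15873 * e^8 * f^7 - 5291
        * e^5 * f^9 + 222 * e^2 * f^11"
proof -
  have c: "c = - (a + b)"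
    using assms(1) by (simp only: eq_neg_iff_add_eq_0 add.commute)
  have rec: "p (k + 3) = f * p k - e * p (k + 1)" for k
    unfolding p_def e_def f_def c by (simp add: power_add algebra_simps power3_eq_cube)
  have p0: "p 0 = 3" and p1: "p (Suc 0) = 0"
    by (simp_all add: p_def assms(1))
  show p2: "p 2 = - 2 * e"
    unfolding p_def e_def c by (simp add: algebra_simps power2_eq_square)
  show p3: "p 3 = 3 * f"
    using rec[of 0] by (simp add: p0 p1)
  show p4: "p 4 = 2 * e^2"
    unfolding p_def e_def c by (simp add: algebra_simps power2_eq_square power4_eq_xxxx)
  show p5: "p 5 = - 5 * e * f"
    using rec[of 2, simplified] unfolding p2 p3 by algebra
  show p6: "p 6 = - 2 * e^3 + 3 * f^2"
    using rec[of 3, simplified] unfolding p3 p4 by algebra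
  show p7: "p 7 = 7 * e^2 * f"
    using rec[of 4, simplified] unfolding p4 p5 by algebra
  show p8: "p 8 = 2 * e^4 - 8 * e * f^2"
    using rec[of 5, simplified] unfolding p5 p6 by algebra
  show p9: "p 9 = - 9 * e^3 * f + 3 * f^3"
    using rec[of 6, simplified] unfolding p6 p7 by algebra
  show p10: "p 10 = - 2 * e^5 + 15 * e^2 * f^2"
    using rec[of 7, simplified] unfolding p7 p8 by algebra
  show p11: "p 11 = 11 * e^4 * f - 11 * e * f^3"
    using rec[of 8, simplified] unfolding p8 p9 by algebra
  show p12: "p 12 = 2 * e^6 - 24 * e^3 * f^2 + 3 * f^4"
    using rec[of 9, simplified] unfolding p9 p10 by algebra
  show p13: "p 13 = - 13 * e^5 * f + 26 * e^2 * f^3"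
    using rec[of 10, simplified] unfolding p10 p11 by algebra
  show p14: "p 14 = - 2 * e^7 + 35 * e^4 * f^2 - 14 * e * f^4"
    using rec[of 11, simplified] unfolding p11 p12 by algebra
  show p15: "p 15 = 15 * e^6 * f - 50 * e^3 * f^3 + 3 * f^5"
    using rec[of 12, simplified] unfolding p12 p13 by algebra
  show p16: "p 16 = 2 * e^8 - 48 * e^5 * f^2 + 40 * e^2 * f^4"
    using rec[of 13, simplified] unfolding p13 p14 by algebra
  show p17: "p 17 = - 17 * e^7 * f + 85 * e^4 * f^3 - 17 * e * f^5"
    using rec[of 14, simplified] unfolding p14 p15 by algebra
  show p18: "p 18 = - 2 * e^9 + 63 * e^6 * f^2 - 90 * e^3 * f^4 + 3 * f^6"
    using rec[of 15, simplified] unfolding p15 p16 by algebra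
  show p19: "p 19 = 19 * e^8 * f - 133 * e^5 * f^3 + 57 * e^2 * f^5"
    using rec[of 16, simplified] unfolding p16 p17 by algebra
  show p20: "p 20 = 2 * e^10 - 80 * e^7 * f^2 + 175 * e^4 * f^4 - 20 * e * f^6"
    using rec[of 17, simplified] unfolding p17 p18 by algebra
  show p21: "p 21 = - 21 * e^9 * f + 196 * e^6 * f^3 - 147 * e^3 * f^5 + 3 * f^7"
    using rec[of 18, simplified] unfolding p18 p19 by algebra
  show p22: "p 22 = - 2 * e^11 + 99 * e^8 * f^2 - 308 * e^5 * f^4 + 77 * e^2 * f^6"
    using rec[of 19, simplified] unfolding p19 p20 by algebra
  show p23: "p 23 = 23 * e^10 * f - 276 * e^7 * f^3 + 322 * e^4 * f^5 - 23 * e * f^7"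
    using rec[of 20, simplified] unfolding p20 p21 by algebra
  show p24: "p 24 = 2 * e^12 - 120 * e^9 * f^2 + 504 * e^6 * f^4 - 224 * e^3 * f^6 + 3 * f^8"
    using rec[of 21, simplified] unfolding p21 p22 by algebra
  show p25: "p 25 = - 25 * e^11 * f + 375 * e^8 * f^3 - 630 * e^5 * f^5 + 100 * e^2 * f^7"
    using rec[of 22, simplified] unfolding p22 p23 by algebra
  show p26: "p 26 = - 2 * e^13 + 143 * e^10 * f^2 - 780 * e^7 * f^4 + 546 * e^4 * f^6 - 26 * e
      * f^8"
    using rec[of 23, simplified] unfolding p23 p24 by algebra
  show p27: "p 27 = 27 * e^12 * f - 495 * e^9 * f^3 + 1134 * e^6 * f^5 - 324 * e^3 * f^7 + 3 * f^9"
    using rec[of 24, simplified] unfolding p24 p25 by algebra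
  show p28: "p 28 = 2 * e^14 - 168 * e^11 * f^2 + 1155 * e^8 * f^4 - 1176 * e^5 * f^6 + 126 * e^2
      * f^8"
    using rec[of 25, simplified] unfolding p25 p26 by algebra
  show p29: "p 29 = - 29 * e^13 * f + 638 * e^10 * f^3 - 1914 * e^7 * f^5 + 870 * e^4 * f^7 - 29
      * e * f^9"
    using rec[of 26, simplified] unfolding p26 p27 by algebra
  show p30: "p 30 = - 2 * e^15 + 195 * e^12 * f^2 - 1650 * e^9 * f^4 + 2310 * e^6 * f^6 - 450
      * e^3 * f^8 + 3 * f^10"
    using rec[of 27, simplified] unfolding p27 p28 by algebra
  show p31: "p 31 = 31 * e^14 * f - 806 * e^11 * f^3 + 3069 * e^8 * f^5 - 2046 * e^5 * f^7 + 155
      * e^2 * f^9"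
    using rec[of 28, simplified] unfolding p28 p29 by algebra
  show p32: "p 32 = 2 * e^16 - 224 * e^13 * f^2 + 2288 * e^10 * f^4 - 4224 * e^7 * f^6 + 1320
      * e^4 * f^8 - 32 * e * f^10"
    using rec[of 29, simplified] unfolding p29 p30 by algebra
  show p33: "p 33 = - 33 * e^15 * f + 1001 * e^12 * f^3 - 4719 * e^9 * f^5 + 4356 * e^6 * f^7
      - 605 * e^3 * f^9 + 3 * f^11"
    using rec[of 30, simplified] unfolding p30 p31 by algebra
  show p34: "p 34 = - 2 * e^17 + 255 * e^14 * f^2 - 3094 * e^11 * f^4 + 7293 * e^8 * f^6 - 3366
      * e^5 * f^8 + 187 * e^2 * f^10"
    using rec[of 31, simplified] unfolding p31 p32 by algebra
  show p35: "p 35 = 35 * e^16 * f - 1225 * e^13 * f^3 + 7007 * e^10 * f^5 - 8580 * e^7 * f^7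
      + 1925 * e^4 * f^9 - 35 * e * f^11"
    using rec[of 32, simplified] unfolding p32 p33 by algebra
  show p36: "p 36 = 2 * e^18 - 288 * e^15 * f^2 + 4095 * e^12 * f^4 - 12012 * e^9 * f^6 + 7722
      * e^6 * f^8 - 792 * e^3 * f^10 + 3 * f^12"
    using rec[of 33, simplified] unfolding p33 p34 by algebra
  show p37: "p 37 = - 37 * e^17 * f + 1480 * e^14 * f^3 - 10101 * e^11 * f^5 + 15873 * e^8 * f^7
      - 5291 * e^5 * f^9 + 222 * e^2 * f^11"
    using rec[of 34, simplified] unfolding p34 p35 by algebra
qed

text \<open>The coefficients solve, for each \<open>n\<close>, the linear system that makes the power sums cancel;
  they were found by computer algebra. For \<open>n = 4\<close> and \<open>n = 6\<close> every solution annihilates the sum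
  of transvection coefficients (there the octahedral and icosahedral codes have dimension \<open>n /
  2\<close>).\<close>

definition syzygy_coeffs :: "nat \<Rightarrow> complex list"
  where "syzygy_coeffs n = the (map_of [
    (8, [14, -91, 143]),
    (10, [-12, 102, -272, 221]),
    (12, [22, -231, 855, -1292, 646]),
    (14, [26, -325, 1495, -2990, 2185]),
    (16, [-68, 986, -5568, 15225, -20010, 10005]),
    (18, [1292, -21318, 142290, -489056, 906192, -849555, 310155]),
    (20, [874, -16169, 123025, -492100, 1089650, -1263994, 598734])] n)"

text \<open>In terms of \<open>e\<close> and \<open>f\<close> every summand is a combination of
  monomials e^i f^j with 2 i + 3 j = 2 n, so only a few coefficients have to cancel.\<close>

lemma syzygy_sum_zero:
  fixes a b c :: complex
  assumes "n \<in> {8, 10, 12, 14, 16, 18, 20}" and "a + b + c = 0"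
  shows "(\<Sum>m=1..length (syzygy_coeffs n). syzygy_coeffs n ! (m - 1) * (a * b * c) ^ m *
    (a ^ (2 * n - 3 * m) + b ^ (2 * n - 3 * m) + c ^ (2 * n - 3 * m))) = 0"
proof -
  define e where "e = a * b + b * c + c * a"
  define f where "f = a * b * c"
  note p = power_sums_sum_zero[OF assms(2) e_def f_def]
  note simps = syzygy_coeffs_def sum.atLeast1_atMost_eq lessThan_nat_numeral
  consider "n = 8" | "n = 10" | "n = 12" | "n = 14" | "n = 16" | "n = 18" | "n = 20"
    using assms(1) by auto
  then show ?thesis
  proof cases
    case 1
    show ?thesis
      unfolding f_def[symmetric] 1 by (simp add: simps del: sum.lessThan_Suc, unfold p, algebra)
  next
    case 2
    show ?thesis
      unfolding f_def[symmetric] 2 by (simp add: simps del: sum.lessThan_Suc, unfold p, algebra)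
  next
    case 3
    show ?thesis
      unfolding f_def[symmetric] 3 by (simp add: simps del: sum.lessThan_Suc, unfold p, algebra)
  next
    case 4
    show ?thesis
      unfolding f_def[symmetric] 4 by (simp add: simps del: sum.lessThan_Suc, unfold p, algebra)
  next
    case 5
    show ?thesis
      unfolding f_def[symmetric] 5 by (simp add: simps del: sum.lessThan_Suc, unfold p, algebra)
  next
    case 6
    show ?thesis
      unfolding f_def[symmetric] 6 by (simp add: simps del: sum.lessThan_Suc, unfold p, algebra)
  next
    case 7
    show ?thesis
      unfolding f_def[symmetric] 7 by (simp add: simps del: sum.lessThan_Suc, unfold p, algebra)
  qed
qed

section \<open>Values of the transvection coefficients\<close>

text \<open>In terms of Beta integrals this expands (t + (1 - t))^N = 1 under the integral of t^a (1
  - t)^b over [0, 1]. The induction rests on the case N = 1, which is \<open>rec\<close>.\<close>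

lemma sum_choose_fact:
  "(\<Sum>k\<le>N. of_nat (N choose k) * (fact (a + k) * fact (b + (N - k)) / fact (Suc (a + b + N))))
    = (fact a * fact b / fact (Suc (a + b)) :: complex)"
proof -
  define B where "B a b = (fact a * fact b / fact (Suc (a + b)) :: complex)" for a b
  have rec: "B a (Suc b) + B (Suc a) b = B a b" for a b
  proof -
    have "complex_of_nat (a + b + 2) \<noteq> 0" by (simp only: of_nat_eq_0_iff)
    have "B a (Suc b) + B (Suc a) b = of_nat (a + b + 2) * fact a * fact b
        / (of_nat (a + b + 2) * fact (Suc (a + b)))"
      by (simp add: B_def add_divide_distrib[symmetric] algebra_simps)
    also have "\<dots> = B a b"
      unfolding mult.assoc B_def by (rule nonzero_mult_divide_mult_cancel_left) fact
    finally show ?thesis .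
  qed
  have "(\<Sum>k\<le>N. of_nat (N choose k) * B (a + k) (b + (N - k))) = B a b"
  proof (induction N arbitrary: b)
    case (Suc N)
    have "(\<Sum>k\<le>Suc N. of_nat (Suc N choose k) * B (a + k) (b + (Suc N - k)))
        = (\<Sum>k\<le>Suc N. of_nat (N choose k) * B (a + k) (b + (Suc N - k)))
          + (\<Sum>k\<le>N. of_nat (N choose k) * B (a + Suc k) (b + (N - k)))"
      unfolding sum.atMost_Suc_shift by (simp add: ring_distribs sum.distrib)
    also have "(\<Sum>k\<le>Suc N. of_nat (N choose k) * B (a + k) (b + (Suc N - k)))
        = (\<Sum>k\<le>N. of_nat (N choose k) * B (a + k) (Suc (b + (N - k))))"
      by (simp add: Suc_diff_le)
    also have "\<dots> + (\<Sum>k\<le>N. of_nat (N choose k) * B (a + Suc k) (b + (N - k)))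
        = (\<Sum>k\<le>N. of_nat (N choose k) * B (a + k) (b + (N - k)))"
      unfolding sum.distrib[symmetric] distrib_left[symmetric] add_Suc_right rec ..
    finally show ?case using Suc.IH by simp
  qed simp
  moreover have "a + k + (b + (N - k)) = a + b + N" if "k \<le> N" for k
    using that by simp
  ultimately show ?thesis
    by (simp add: B_def add.assoc del: fact_Suc)
qed

text \<open>The reciprocal of n choose j is n + 1 times the Beta value j! (n - j)! / (n + 1)!, so
  \<open>sum_choose_fact\<close> applies with a = b = m and N = n - 2 m.\<close>

lemma transvection_coeff_eq:
  assumes "2 * m \<le> n"
  shows "transvection_coeff n m = of_nat (n + 1) * (fact m * fact m / fact (2 * m + 1))"
proof -
  have "transvection_coeff n m = (\<Sum>k\<le>n - 2 * m. of_nat (n + 1) * (of_nat ((n - 2 * m) choose k) *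
      (fact (m + k) * fact (m + (n - 2 * m - k)) / fact (Suc (m + m + (n - 2 * m))))))"
    unfolding transvection_coeff_def
  proof (intro sum.cong refl)
    fix k assume "k \<in> {..n - 2 * m}"
    then have e: "n - (m + k) = m + (n - 2 * m - k)" "m + k \<le> n" "m + m + (n - 2 * m) = n"
      using assms by auto
    define D where "D = complex_of_nat (n + 1)"
    have D: "D \<noteq> 0" "fact (Suc n) = D * fact n"
      by (simp_all only: D_def of_nat_eq_0_iff fact_Suc Suc_eq_plus1[symmetric])
    then show "of_nat ((n - 2 * m) choose k) / of_nat (n choose (m + k)) = of_nat (n + 1)
        * (of_nat ((n - 2 * m) choose k) *
      (fact (m + k) * fact (m + (n - 2 * m - k)) / fact (Suc (m + m + (n - 2 * m)))) :: complex)"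
      unfolding e(3) binomial_fact[OF e(2)] e(1) D_def[symmetric] D(2) using D(1) by simp
  qed
  then show ?thesis
    by (simp only: sum_choose_fact sum_distrib_left[symmetric] mult_2 Suc_eq_plus1[symmetric])
qed

lemma transvection_syzygy_nonzero:
  assumes "n \<in> {8, 10, 12, 14, 16, 18, 20}"
  shows "(\<Sum>m=1..length (syzygy_coeffs n). syzygy_coeffs n ! (m - 1) * transvection_coeff n m) \<noteq> 0"
proof -
  note simps = syzygy_coeffs_def sum.atLeast1_atMost_eq lessThan_nat_numeral transvection_coeff_eq
      fact_numeral
  consider "n = 8" | "n = 10" | "n = 12" | "n = 14" | "n = 16" | "n = 18" | "n = 20"
    using assms by auto
  then show ?thesis
  proof cases
    case 1
    then show ?thesis by (simp add: simps)
  next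
    case 2
    then show ?thesis by (simp add: simps)
  next
    case 3
    then show ?thesis by (simp add: simps)
  next
    case 4
    then show ?thesis by (simp add: simps)
  next
    case 5
    then show ?thesis by (simp add: simps)
  next
    case 6
    then show ?thesis by (simp add: simps)
  next
    case 7
    then show ?thesis by (simp add: simps)
  qed
qed

section \<open>Projections without spin expectation\<close>

lemma sum_sq_centered: "(\<Sum>i<n. ((real n - 1) / 2 - real i)\<^sup>2) = (real n - 1) * real n
    * (real n + 1) / 12"
proof -
  have a: "(\<Sum>i<n. real i) = real n * (real n - 1) / 2"
    by (induction n) (auto simp: field_simps)
  have b: "(\<Sum>i<n. (real i)\<^sup>2) = (real n - 1) * real n * (2 * real n - 1) / 6"
    by (induction n) (auto simp: field_simps power2_eq_square)
  have "(\<Sum>i<n. ((real n - 1) / 2 - real i)\<^sup>2)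
      = (\<Sum>i<n. ((real n - 1) / 2)\<^sup>2 - (real n - 1) * real i + (real i)\<^sup>2)"
    by (intro sum.cong refl) (simp add: power2_eq_square field_simps)
  also have "\<dots> = real n * ((real n - 1) / 2)\<^sup>2 - (real n - 1) * (real n * (real n - 1) / 2)
      + (real n - 1) * real n * (2 * real n - 1) / 6"
    by (simp add: sum.distrib sum_subtractf a b flip: sum_distrib_left)
  finally show ?thesis by (simp add: power2_eq_square field_simps)
qed

lemma sum_centered: "(\<Sum>i<n. ((real n - 1) / 2 - real i)) = 0"
proof -
  have "(\<Sum>i<n. real i) = real n * (real n - 1) / 2"
    by (induction n) (auto simp: field_simps)
  then show ?thesis by (simp add: sum_subtractf)
qed

text \<open>Collects the factor of each \<open>f i\<close>. At the ends of the range the factors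
  \<open>of_nat 0\<close> and \<open>of_nat (n - n)\<close> absorb the truncated
  \<open>a (0 - 1)\<close> and the extra \<open>a n\<close>.\<close>

lemma sum_shift_diagonal:
  fixes f :: "nat \<Rightarrow> 'a :: comm_ring_1"
  shows "(\<Sum>i<n. a i * (of_nat (Suc i) * f (Suc i) + of_nat (n - i) * f i))
     = (\<Sum>i\<le>n. (of_nat i * a (i - 1) + of_nat (n - i) * a i) * f i)"
proof -
  have "(\<Sum>i<n. a i * (of_nat (Suc i) * f (Suc i))) = (\<Sum>i\<le>n. of_nat i * a (i - 1) * f i)"
    unfolding sum.atMost_shift by (simp add: algebra_simps)
  moreover have "(\<Sum>i<n. a i * (of_nat (n - i) * f i)) = (\<Sum>i\<le>n. of_nat (n - i) * a i * f i)"
    by (simp add: lessThan_Suc_atMost[symmetric] algebra_simps)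
  ultimately show ?thesis
    by (simp add: ring_distribs sum.distrib)
qed

text \<open>The operator \<open>P \<mapsto> Y\<close> contracts the two legs of \<open>P\<close> to spin \<open>(n - 1) / 2\<close>, so the norm of \<open>Y\<close>
  measures how far \<open>P\<close> is from the top component of its Clebsch--Gordan decomposition. The claim
  is the equality case of the Bessel inequality for \<open>Y\<close> against the identity and the third spin
  component.\<close>

lemma contraction_rigid:
  fixes P :: "nat \<Rightarrow> nat \<Rightarrow> complex" and c :: real
  assumes K: "n = 2 * K" "2 \<le> K"
    and herm: "\<And>i k. cnj (P i k) = P k i"
    and tr: "(\<Sum>i\<le>n. P i i) = of_nat K"
    and sq: "(\<Sum>i\<le>n. \<Sum>k\<le>n. P i k * P k i) = of_nat K"
    and trH: "(\<Sum>i\<le>n. of_real (real K - real i) * P i i) = of_real (c * real K)"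
    and sqH: "(\<Sum>i\<le>n. \<Sum>k\<le>n. of_real ((real K - real i) * (real K - real k)) * (P i k * P k i))
        = of_real (c\<^sup>2 * real K)"
    and ladder: "(\<Sum>i<n. \<Sum>k<n. of_real (sqrt (real (Suc i) * real (n - i))
        * sqrt (real (Suc k) * real (n - k))) *
        (P (Suc i) (Suc k) * P k i)) = 0"
    and ik: "i < n" "k < n"
  shows "of_real (sqrt (real (Suc i) * real (Suc k))) * P (Suc i) (Suc k)
      + of_real (sqrt (real (n - i) * real (n - k))) * P i k = (if i = k then of_nat K else 0)"
proof -
  define r where "r i = complex_of_real (sqrt (real (Suc i)))" for i
  define t where "t i = complex_of_real (sqrt (real (n - i)))" for i
  define Y where "Y i k = r i * r k * P (Suc i) (Suc k) + t i * t k * P i k" for i k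
  have rr: "r i * r i = of_nat (Suc i)" and tt: "t i * t i = of_nat (n - i)" for i
    unfolding r_def t_def of_real_mult[symmetric] by simp_all
  \<comment> \<open>In the squared norm of \<open>Y\<close> the mixed terms are
    \<open>ladder\<close> and its transpose, so only the two pure terms survive.\<close>
  have cross: "(\<Sum>i<n. \<Sum>k<n. r i * r k * t i * t k * (P (Suc i) (Suc k) * P k i)) = 0"
    using ladder by (simp add: r_def t_def real_sqrt_mult mult_ac)
  have cross': "(\<Sum>i<n. \<Sum>k<n. r i * r k * t i * t k * (P i k * P (Suc k) (Suc i))) = 0"
    using cross by (subst sum.swap) (simp add: mult_ac)
  have "(\<Sum>i<n. \<Sum>k<n. Y i k * Y k i) = (\<Sum>i<n. \<Sum>k<n. of_nat (Suc i) * of_nat (Suc k)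
      * (P (Suc i) (Suc k) * P (Suc k) (Suc i))
      + of_nat (n - i) * of_nat (n - k) * (P i k * P k i)
      + r i * r k * t i * t k * (P (Suc i) (Suc k) * P k i) + r i * r k * t i * t k
          * (P i k * P (Suc k) (Suc i)))"
  proof (intro sum.cong refl)
    fix i k
    have "Y i k * Y k i = (r i * r i) * (r k * r k) * (P (Suc i) (Suc k) * P (Suc k) (Suc i))
      + (t i * t i) * (t k * t k) * (P i k * P k i)
      + r i * r k * t i * t k * (P (Suc i) (Suc k) * P k i) + r i * r k * t i * t k
          * (P i k * P (Suc k) (Suc i))"
      unfolding Y_def by (simp add: algebra_simps)
    then show "Y i k * Y k i = of_nat (Suc i) * of_nat (Suc k)
        * (P (Suc i) (Suc k) * P (Suc k) (Suc i))
      + of_nat (n - i) * of_nat (n - k) * (P i k * P k i)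
      + r i * r k * t i * t k * (P (Suc i) (Suc k) * P k i) + r i * r k * t i * t k
          * (P i k * P (Suc k) (Suc i))"
      unfolding rr tt .
  qed
  also have "\<dots> = (\<Sum>i<n. \<Sum>k<n. of_nat (Suc i) * of_nat (Suc k)
      * (P (Suc i) (Suc k) * P (Suc k) (Suc i)))
      + (\<Sum>i<n. \<Sum>k<n. of_nat (n - i) * of_nat (n - k) * (P i k * P k i))"
    by (simp only: sum.distrib cross cross' add_0_right)
  also have "(\<Sum>i<n. \<Sum>k<n. of_nat (Suc i) * of_nat (Suc k) * (P (Suc i) (Suc k) * P (Suc k) (Suc i)))
      = (\<Sum>i\<le>n. \<Sum>k\<le>n. of_nat i * of_nat k * (P i k * P k i))"
    unfolding sum.atMost_shift by simp
  also have "(\<Sum>i<n. \<Sum>k<n. of_nat (n - i) * of_nat (n - k) * (P i k * P k i))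
      = (\<Sum>i\<le>n. \<Sum>k\<le>n. of_nat (n - i) * of_nat (n - k) * (P i k * P k i))"
    by (simp add: lessThan_Suc_atMost[symmetric])
  \<comment> \<open>With n = 2 K one has i k + (n - i)(n - k) = 2 K^2 + 2 (K - i)(K - k), so
    \<open>sq\<close> and \<open>sqH\<close> determine the norm.\<close>
  also have "(\<Sum>i\<le>n. \<Sum>k\<le>n. of_nat i * of_nat k * (P i k * P k i)) + \<dots>
      = (\<Sum>i\<le>n. \<Sum>k\<le>n. 2 * (of_nat K)\<^sup>2 * (P i k * P k i) + 2
          * (of_real ((real K - real i) * (real K - real k)) * (P i k * P k i)))"
    unfolding sum.distrib[symmetric]
    by (intro sum.cong refl) (simp add: K of_nat_diff power2_eq_square algebra_simps)
  also have "\<dots> = 2 * (of_nat K)\<^sup>2 * of_nat K + 2 * of_real (c\<^sup>2 * real K)"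
    by (simp only: sum.distrib flip: sum_distrib_left) (simp only: sq sqH)
  finally have YY: "(\<Sum>i<n. \<Sum>k<n. Y i k * Y k i) = of_real (2 * real K ^ 3 + 2 * c\<^sup>2 * real K)"
    by (simp add: power2_eq_square power3_eq_cube)
  have Ydiag: "Y i i = of_nat (Suc i) * P (Suc i) (Suc i) + of_nat (n - i) * P i i" for i
    unfolding Y_def rr tt ..
  have trY: "(\<Sum>i<n. Y i i) = of_real (2 * (real K)\<^sup>2)"
  proof -
    have "(\<Sum>i<n. Y i i) = (\<Sum>i\<le>n. (of_nat i + of_nat (n - i)) * P i i)"
      using sum_shift_diagonal[of "\<lambda>_. 1" "\<lambda>i. P i i" n] unfolding Ydiag by simp
    also have "\<dots> = (\<Sum>i\<le>n. of_nat n * P i i)"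
      by (intro sum.cong refl) (simp flip: of_nat_add)
    also have "\<dots> = of_nat n * of_nat K"
      by (simp add: tr flip: sum_distrib_left)
    finally show ?thesis by (simp add: K power2_eq_square)
  qed
  \<comment> \<open>The weights of spin (n - 1) / 2. They sum to zero, so as a diagonal operator
    they are orthogonal to the identity.\<close>
  define \<nu> where "\<nu> i = (real n - 1) / 2 - real i" for i
  have nuY: "(\<Sum>i<n. of_real (\<nu> i) * Y i i) = of_real ((2 * real K - 1) * c * real K)"
  proof -
    have "(\<Sum>i<n. of_real (\<nu> i) * Y i i)
        = (\<Sum>i\<le>n. (of_nat i * of_real (\<nu> (i - 1)) + of_nat (n - i) * of_real (\<nu> i)) * P i i)"
      unfolding Ydiag by (rule sum_shift_diagonal)
    also have "\<dots> = (\<Sum>i\<le>n. of_real (2 * real K - 1) * (of_real (real K - real i) * P i i))"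
    proof (intro sum.cong refl)
      fix i assume "i \<in> {..n}"
      then have "i = 0 \<or> real (i - 1) = real i - 1" "real (n - i) = real n - real i"
        by (auto simp: of_nat_diff)
      then have "real i * \<nu> (i - 1) + real (n - i) * \<nu> i = (2 * real K - 1) * (real K - real i)"
        by (auto simp: \<nu>_def K field_simps)
      then have "complex_of_real (real i * \<nu> (i - 1) + real (n - i) * \<nu> i)
          = of_real ((2 * real K - 1) * (real K - real i))"
        by (rule arg_cong)
      then show "(of_nat i * of_real (\<nu> (i - 1)) + of_nat (n - i) * of_real (\<nu> i)) * P i i
          = of_real (2 * real K - 1) * (of_real (real K - real i) * P i i)"
        by (simp only: of_real_add of_real_mult of_real_of_nat_eq mult.assoc)
    qed
    also have "\<dots> = of_real ((2 * real K - 1) * c * real K)"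
      unfolding sum_distrib_left[symmetric] trH by simp
    finally show ?thesis .
  qed
  \<comment> \<open>K and \<gamma> are the coefficients of the orthogonal projection of
    \<open>Y\<close> to the span of the identity and the diagonal operator \<nu>: K is tr Y / n, and
    \<gamma> is the inner product with \<nu> divided by (n - 1) n (n + 1) / 12. \<open>Z\<close> is
    the remainder.\<close>
  define \<gamma> where "\<gamma> = 6 * c / (2 * real K + 1)"
  define d where "d i = real K + \<gamma> * \<nu> i" for i
  define Z where "Z i k = Y i k - (if i = k then of_real (d i) else 0)" for i k
  have dY: "(\<Sum>i<n. of_real (d i) * Y i i)
      = of_real (2 * real K ^ 3 + \<gamma> * ((2 * real K - 1) * c * real K))"
  proof -
    have "(\<Sum>i<n. of_real (d i) * Y i i) = of_real (real K) * (\<Sum>i<n. Y i i) + of_real \<gamma>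
        * (\<Sum>i<n. of_real (\<nu> i) * Y i i)"
      unfolding sum_distrib_left sum.distrib[symmetric]
          by (intro sum.cong refl) (simp add: d_def algebra_simps)
    then show ?thesis unfolding trY nuY by (simp add: power3_eq_cube power2_eq_square)
  qed
  have dd: "(\<Sum>i<n. (d i)\<^sup>2) = real n * (real K)\<^sup>2 + \<gamma>\<^sup>2
      * ((real n - 1) * real n * (real n + 1) / 12)"
  proof -
    have "(\<Sum>i<n. (d i)\<^sup>2) = (\<Sum>i<n. (real K)\<^sup>2 + 2 * real K * \<gamma> * \<nu> i + \<gamma>\<^sup>2 * (\<nu> i)\<^sup>2)"
      by (simp add: d_def power2_eq_square algebra_simps)
    also have "\<dots> = real n * (real K)\<^sup>2 + 2 * real K * \<gamma> * (\<Sum>i<n. \<nu> i) + \<gamma>\<^sup>2 * (\<Sum>i<n. (\<nu> i)\<^sup>2)"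
      by (simp add: sum.distrib flip: sum_distrib_left)
    finally show ?thesis by (simp add: \<nu>_def sum_centered sum_sq_centered)
  qed
  have "complex_of_real (\<Sum>i<n. \<Sum>k<n. (cmod (Z i k))\<^sup>2) = (\<Sum>i<n. \<Sum>k<n. Z i k * Z k i)"
  proof -
    have "cnj (Z i k) = Z k i" for i k
      by (simp add: Z_def Y_def herm r_def t_def mult_ac)
    then have "Z i k * Z k i = of_real ((cmod (Z i k))\<^sup>2)" for i k
      by (simp only: complex_norm_square)
    then show ?thesis
      by (simp only: of_real_sum)
  qed
  also have "\<dots> = (\<Sum>i<n. \<Sum>k<n. Y i k * Y k i
      + (if k = i then of_real ((d i)\<^sup>2) - 2 * of_real (d i) * Y i i else 0))"
    by (intro sum.cong refl) (auto simp: Z_def power2_eq_square algebra_simps)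
  also have "\<dots> = (\<Sum>i<n. \<Sum>k<n. Y i k * Y k i)
      + (of_real (\<Sum>i<n. (d i)\<^sup>2) - 2 * (\<Sum>i<n. of_real (d i) * Y i i))"
    by (simp add: sum.distrib sum_subtractf sum_distrib_left mult.assoc)
  also have "\<dots> = of_real (2 * real K ^ 3 + 2 * c\<^sup>2 * real K
      + (real n * (real K)\<^sup>2 + \<gamma>\<^sup>2 * ((real n - 1) * real n * (real n + 1) / 12)
      - 2 * (2 * real K ^ 3 + \<gamma> * ((2 * real K - 1) * c * real K))))"
    unfolding YY dY dd by simp
  finally have "(\<Sum>i<n. \<Sum>k<n. (cmod (Z i k))\<^sup>2) = 2 * real K ^ 3 + 2 * c\<^sup>2 * real K
      + (real n * (real K)\<^sup>2 + \<gamma>\<^sup>2 * ((real n - 1) * real n * (real n + 1) / 12)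
      - 2 * (2 * real K ^ 3 + \<gamma> * ((2 * real K - 1) * c * real K)))"
    by (simp only: of_real_eq_iff)
  \<comment> \<open>Because K = n / 2, the part 2 K^3 of the squared norm of \<open>Y\<close>
    cancels against its identity component, and a nonpositive multiple of c^2 remains.\<close>
  also have "\<dots> = - (8 * c\<^sup>2 * real K * (real K - 1) / (2 * real K + 1))"
  proof -
    have "\<gamma> * (2 * real K + 1) = 6 * c" by (simp add: \<gamma>_def)
    moreover have "2 * real K + 1 \<noteq> 0" by linarith
    ultimately show ?thesis
      unfolding K by (simp add: field_simps) algebra
  qed
  finally have sumZ: "(\<Sum>i<n. \<Sum>k<n. (cmod (Z i k))\<^sup>2) =
      - (8 * c\<^sup>2 * real K * (real K - 1) / (2 * real K + 1))" .
  \<comment> \<open>A sum of squares that is at most zero: \<open>Z\<close> vanishes, and K > 1 also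
    forces c = 0, so \<open>Y\<close> is K times the identity.\<close>
  have "0 \<le> (\<Sum>i<n. \<Sum>k<n. (cmod (Z i k))\<^sup>2)"
    by (intro sum_nonneg) simp
  moreover have "0 \<le> 8 * c\<^sup>2 * real K * (real K - 1) / (2 * real K + 1)"
    using K by simp
  ultimately have Z0: "(\<Sum>i<n. \<Sum>k<n. (cmod (Z i k))\<^sup>2) = 0" and "8 * c\<^sup>2 * real K * (real K - 1)
      / (2 * real K + 1) = 0"
    unfolding sumZ by linarith+
  moreover have "2 * real K + 1 \<noteq> 0" by linarith
  ultimately have "c = 0"
    using K by auto
  have "Z i k = 0"
  proof -
    have "(\<Sum>k<n. (cmod (Z i k))\<^sup>2) = 0"
      using Z0 ik by (subst (asm) sum_nonneg_eq_0_iff) (auto intro: sum_nonneg)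
    then show ?thesis
      using ik by (subst (asm) sum_nonneg_eq_0_iff) auto
  qed
  then show ?thesis
    using \<open>c = 0\<close> by (simp add: Z_def Y_def r_def t_def d_def \<gamma>_def real_sqrt_mult split: if_splits)
qed

section \<open>Rigid projections as Hankel matrices\<close>

text \<open>Subtracting the scalar part \<alpha> makes \<open>rigid\<close> a homogeneous recurrence
  along diagonals. Scaling by signs and square roots of binomial coefficients makes the entries
  constant on diagonals, and P^2 = P becomes the quadratic hypothesis of \<open>hankel_zero\<close>.
  Once \<open>h\<close> vanishes, its case i = 0, k = n reads \<beta> = 0.\<close>

lemma no_rigid_projection:
  fixes P :: "nat \<Rightarrow> nat \<Rightarrow> complex"
  assumes n: "n = 2 * K" "n \<in> {8, 10, 12, 14, 16, 18, 20}"
    and idem: "\<And>i k. i \<le> n \<Longrightarrow> k \<le> n \<Longrightarrow> (\<Sum>l\<le>n. P i l * P l k) = P i k"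
    and rigid: "\<And>i k. i < n \<Longrightarrow> k < n \<Longrightarrow> of_real (sqrt (real (Suc i) * real (Suc k)))
        * P (Suc i) (Suc k)
      + of_real (sqrt (real (n - i) * real (n - k))) * P i k = (if i = k then of_nat K else 0)"
  shows False
proof -
  \<comment> \<open>The scalar solution of \<open>rigid\<close>: for i = k its two coefficients add
    up to (i + 1) + (n - i) = n + 1.\<close>
  define \<alpha> where "\<alpha> = complex_of_nat K / (of_nat n + 1)"
  have n1: "complex_of_nat n + 1 \<noteq> 0"
    using of_nat_eq_0_iff[of "Suc n", where 'a = complex] by (simp add: add.commute)
  have \<alpha>: "\<alpha> * (of_nat n + 1) = of_nat K"
    using n1 by (simp add: \<alpha>_def)
  define r where "r i = complex_of_real (sqrt (real (Suc i)))" for i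
  define t where "t i = complex_of_real (sqrt (real (n - i)))" for i
  define B where "B i = complex_of_real (sqrt (real (n choose i)))" for i
  define T where "T i k = P i k - (if i = k then \<alpha> else 0)" for i k
  \<comment> \<open>Since \<open>r i * B (Suc i) = t i * B i\<close>, division by
    \<open>B i * B k\<close> absorbs the coefficients of the recurrence, and (-1)^i absorbs its
    sign.\<close>
  define \<tau> where "\<tau> i k = (-1) ^ i * T i k / (B i * B k)" for i k
  \<comment> \<open>\<open>h q\<close> is the value of \<tau> on the diagonal i + n - k = q, read
    off in row 0 or column 0.\<close>
  define h where "h q = (if q \<le> n then \<tau> 0 (n - q) else \<tau> (q - n) 0)" for q
  have rr: "r i * r i = of_nat (Suc i)" and tt: "t i * t i = of_nat (n - i)" and BB: "B i * B i
      = of_nat (n choose i)" for i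
    unfolding r_def t_def B_def of_real_mult[symmetric] by simp_all
  have Bnz: "B i \<noteq> 0" if "i \<le> n" for i
    using that by (simp add: B_def)
  have rnz: "r i \<noteq> 0" for i
    by (simp add: r_def)
  have tnz: "t i \<noteq> 0" if "i < n" for i
    using that by (simp add: t_def)
  have Bstep: "r i * B (Suc i) = t i * B i" for i
  proof -
    have "real (Suc i) * real (n choose Suc i) = real (n - i) * real (n choose i)"
      by (metis Suc_times_binomial_eq binomial_absorb_comp mult.commute of_nat_mult
          binomial_absorption)
    then show ?thesis
      unfolding r_def t_def B_def of_real_mult[symmetric] real_sqrt_mult[symmetric] by simp
  qed
  have rigid': "r i * r k * P (Suc i) (Suc k) + t i * t k * P i k = (if i = k then of_nat K else 0)"
    if "i < n" "k < n" for i k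
    using rigid[OF that] by (simp only: r_def t_def real_sqrt_mult of_real_mult)
  have Tstep: "r i * r k * T (Suc i) (Suc k) = - (t i * t k * T i k)" if "i < n" "k < n" for i k
  proof (cases "i = k")
    case True
    have "r i * r k * P (Suc i) (Suc k) + t i * t k * P i k = of_nat K"
      using rigid'[OF that] True by simp
    moreover have "r i * r k + t i * t k = of_nat n + 1"
      using that by (simp add: True rr tt of_nat_diff)
    ultimately have "r i * r k * T (Suc i) (Suc k) + t i * t k * T i k = 0"
      using \<alpha> True by (simp add: T_def algebra_simps)
          (metis (no_types, lifting) distrib_left mult.commute mult_1)
    then show ?thesis by (simp add: eq_neg_iff_add_eq_0)
  next
    case False
    then show ?thesis
      using rigid'[OF that] by (simp add: T_def eq_neg_iff_add_eq_0)
  qed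
  have \<tau>step: "\<tau> (Suc i) (Suc k) = \<tau> i k" if "i < n" "k < n" for i k
  proof -
    have "r i * r k * T (Suc i) (Suc k) / ((r i * B (Suc i)) * (r k * B (Suc k)))
        = - (t i * t k * T i k) / ((t i * B i) * (t k * B k))"
      unfolding Tstep[OF that] Bstep ..
    then have "T (Suc i) (Suc k) / (B (Suc i) * B (Suc k)) = - T i k / (B i * B k)"
      using rnz[of i] rnz[of k] tnz[of i] tnz[of k] that by simp
    then show ?thesis
      by (simp only: \<tau>_def times_divide_eq_right[symmetric]) simp
  qed
  have \<tau>_up: "i + d \<le> n \<Longrightarrow> \<tau> i (i + d) = \<tau> 0 d" and \<tau>_down: "i + d \<le> n \<Longrightarrow> \<tau> (i + d) i = \<tau> d 0" for i d
    by (induction i) (auto simp: \<tau>step)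
  have \<tau>h: "\<tau> i k = h (i + n - k)" if "i \<le> n" "k \<le> n" for i k
  proof (cases "i \<le> k")
    case True
    then have "\<tau> i (i + (k - i)) = \<tau> 0 (k - i)"
      using that by (intro \<tau>_up) auto
    moreover have "i + n - k \<le> n" "n - (i + n - k) = k - i" using True that by auto
    ultimately show ?thesis
      using True by (simp add: h_def)
  next
    case False
    then have "\<tau> (k + (i - k)) k = \<tau> (i - k) 0"
      using that by (intro \<tau>_down) auto
    moreover have "\<not> i + n - k \<le> n" "i + n - k - n = i - k" using False that by auto
    ultimately show ?thesis
      using False by (simp add: h_def)
  qed
  define \<nu> where "\<nu> = 1 - 2 * \<alpha>"
  define \<beta> where "\<beta> = \<alpha> - \<alpha>\<^sup>2"
  have TT: "(\<Sum>l\<le>n. T i l * T l k) = \<nu> * T i k + (if i = k then \<beta> else 0)" if "i \<le> n" "k \<le> n" for i k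
  proof -
    have "(\<Sum>l\<le>n. T i l * T l k) = (\<Sum>l\<le>n. P i l * P l k - (if l = k then \<alpha> * P i k else 0)
        - (if l = i then \<alpha> * P i k else 0) + (if l = k then (if i = k then \<alpha>\<^sup>2 else 0) else 0))"
      by (intro sum.cong refl) (auto simp: T_def algebra_simps power2_eq_square)
    also have "\<dots> = P i k - \<alpha> * P i k - \<alpha> * P i k + (if i = k then \<alpha>\<^sup>2 else 0)"
      using that by (simp add: sum.distrib sum_subtractf idem)
    finally show ?thesis
      by (auto simp: T_def \<nu>_def \<beta>_def algebra_simps power2_eq_square)
  qed
  have E: "(\<Sum>l\<le>n. (-1)^l * of_nat (n choose l) * h (i + n - l) * h (l + k))
      = \<nu> * h (i + k) + (if i + k = n then \<beta> * (-1)^i / of_nat (n choose i) else 0)"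
    if ik: "i \<le> n" "k \<le> n" for i k
  proof -
    \<comment> \<open>Reversing the column index turns a matrix that is constant on diagonals into a
      Hankel matrix.\<close>
    define k' where "k' = n - k"
    have k': "k' \<le> n" "k = n - k'" "i + k = n \<longleftrightarrow> i = k'"
      using ik by (auto simp: k'_def)
    have "(\<Sum>l\<le>n. (-1)^l * of_nat (n choose l) * h (i + n - l) * h (l + k))
        = (\<Sum>l\<le>n. (-1) ^ i / (B i * B k') * (T i l * T l k'))"
    proof (intro sum.cong refl)
      fix l assume "l \<in> {..n}"
      then have l: "l \<le> n" by simp
      have "h (i + n - l) = \<tau> i l" using \<tau>h[of i l] ik l by simp
      moreover have "h (l + k) = \<tau> l k'"
        using \<tau>h[of l k'] l k' by simp
      moreover have "(-1) ^ l * of_nat (n choose l) * \<tau> i l * \<tau> l k'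
          = ((-1) ^ l * (-1) ^ l) * ((B l * B l) / (B l * B l))
              * ((-1) ^ i / (B i * B k') * (T i l * T l k'))"
        unfolding \<tau>_def BB[symmetric] by (simp add: mult_ac)
      moreover have "(-1) ^ l * (-1) ^ l = (1 :: complex)"
        by (simp flip: power_add)
      ultimately show "(-1)^l * of_nat (n choose l) * h (i + n - l) * h (l + k) = (-1) ^ i
          / (B i * B k') * (T i l * T l k')"
        using Bnz[OF l] by simp
    qed
    also have "\<dots> = (-1) ^ i / (B i * B k') * (\<nu> * T i k' + (if i = k' then \<beta> else 0))"
      unfolding sum_distrib_left[symmetric] TT[OF ik(1) k'(1)] ..
    also have "\<dots> = \<nu> * \<tau> i k' + (if i = k' then \<beta> * (-1)^i / (B i * B i) else 0)"
      by (simp add: \<tau>_def algebra_simps)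
    also have "\<tau> i k' = h (i + k)"
      using \<tau>h[of i k'] ik k' by simp
    finally show ?thesis
      unfolding BB k'(3) .
  qed
  have \<beta>: "\<beta> \<noteq> 0"
  proof -
    have "\<alpha> \<noteq> 0" using n by (auto simp: \<alpha>_def n1)
    moreover have "\<alpha> \<noteq> 1"
    proof
      assume "\<alpha> = 1"
      then have "complex_of_nat (n + 1) = of_nat K" using \<alpha> by (simp add: add.commute)
      then have "n + 1 = K" by (simp only: of_nat_eq_iff)
      then show False using n by simp
    qed
    ultimately show ?thesis
      by (simp add: \<beta>_def power2_eq_square)
  qed
  have "\<forall>q\<le>2 * n. h q = 0"
  proof (rule hankel_zero[OF E _ \<beta> _ syzygy_sum_zero transvection_syzygy_nonzero])
    show "even n" using n by simp
    show "2 * length (syzygy_coeffs n) < n"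
      using n(2) by (auto simp: syzygy_coeffs_def)
  qed (use n(2) in auto)
  then show False
    using E[of 0 n] \<beta> by simp
qed

text \<open>With P expanded in code vectors, this rewrites a trace of the form tr(P A P B) as a sum
  of products of matrix elements of A and B on the code.\<close>

lemma sum_product_factor:
  fixes X :: "'i \<Rightarrow> 'l \<Rightarrow> 'a :: comm_semiring_0"
  shows "(\<Sum>i\<in>I. \<Sum>k\<in>J. (\<Sum>l\<in>L. X i l * Y k l) * (\<Sum>m\<in>L. Z k m * W i m))
    = (\<Sum>l\<in>L. \<Sum>m\<in>L. (\<Sum>i\<in>I. W i m * X i l) * (\<Sum>k\<in>J. Y k l * Z k m))"
proof -
  have "(\<Sum>i\<in>I. \<Sum>k\<in>J. (\<Sum>l\<in>L. X i l * Y k l) * (\<Sum>m\<in>L. Z k m * W i m))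
      = (\<Sum>i\<in>I. \<Sum>k\<in>J. \<Sum>l\<in>L. \<Sum>m\<in>L. W i m * X i l * (Y k l * Z k m))"
    by (simp only: sum_product) (simp only: mult_ac)
  also have "\<dots> = (\<Sum>l\<in>L. \<Sum>m\<in>L. \<Sum>i\<in>I. \<Sum>k\<in>J. W i m * X i l * (Y k l * Z k m))"
    by (subst sum_rotate3) (rule sum.cong[OF refl sum_rotate3])
  finally show ?thesis by (simp add: sum_product)
qed

text \<open>The columns of \<open>V\<close> are weight coordinates of K orthonormal code vectors;
  \<open>lower\<close> and \<open>diag\<close> say that the lowering operator compresses to 0 and
  the third spin component to c. For the projection onto their span these compressions supply the
  traces that \<open>contraction_rigid\<close> needs.\<close>

lemma no_isometry:
  fixes V :: "nat \<Rightarrow> nat \<Rightarrow> complex" and c :: real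
  assumes n: "n = 2 * K" "n \<in> {8, 10, 12, 14, 16, 18, 20}"
    and orth: "\<And>l m. l < K \<Longrightarrow> m < K \<Longrightarrow> (\<Sum>i\<le>n. cnj (V i l) * V i m) = (if l = m then 1 else 0)"
    and lower: "\<And>l m. l < K \<Longrightarrow> m < K \<Longrightarrow>
      (\<Sum>i<n. of_real (sqrt (real (Suc i) * real (n - i))) * (cnj (V (Suc i) l) * V i m)) = 0"
    and diag: "\<And>l m. l < K \<Longrightarrow> m < K \<Longrightarrow>
      (\<Sum>i\<le>n. of_real (real K - real i) * (cnj (V i l) * V i m)) = (if l = m then of_real c else 0)"
  shows False
proof -
  define P where "P i k = (\<Sum>l<K. V i l * cnj (V k l))" for i k
  have herm: "cnj (P i k) = P k i" for i k
    by (simp add: P_def mult.commute)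
  have idem: "(\<Sum>l\<le>n. P i l * P l k) = P i k" for i k
  proof -
    have "(\<Sum>j\<le>n. P i j * P j k) = (\<Sum>j\<le>n. \<Sum>l<K. \<Sum>m<K. V i l * cnj (V k m) * (cnj (V j l) * V j m))"
      by (simp only: P_def sum_product) (simp only: mult_ac)
    also have "\<dots> = (\<Sum>l<K. \<Sum>m<K. \<Sum>j\<le>n. V i l * cnj (V k m) * (cnj (V j l) * V j m))"
      by (rule sum_rotate3[symmetric])
    also have "\<dots> = P i k"
      by (simp add: orth P_def if_distrib cong: if_cong flip: sum_distrib_left)
    finally show ?thesis .
  qed
  have diag_sum: "(\<Sum>i\<le>n. f i * P i i) = (\<Sum>l<K. \<Sum>i\<le>n. f i * (cnj (V i l) * V i l))" for f
    unfolding P_def sum_distrib_left by (subst sum.swap) (simp add: mult_ac)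
  have tr: "(\<Sum>i\<le>n. P i i) = of_nat K"
    using diag_sum[of "\<lambda>_. 1"] by (simp add: orth)
  have trH: "(\<Sum>i\<le>n. of_real (real K - real i) * P i i) = of_real (c * real K)"
    unfolding diag_sum by (simp add: diag del: of_real_diff)
  have sq: "(\<Sum>i\<le>n. \<Sum>k\<le>n. P i k * P k i) = of_nat K"
    by (simp add: idem tr)
  have sqH: "(\<Sum>i\<le>n. \<Sum>k\<le>n. of_real ((real K - real i) * (real K - real k)) * (P i k * P k i))
      = of_real (c\<^sup>2 * real K)"
  proof -
    have "(\<Sum>i\<le>n. \<Sum>k\<le>n. of_real ((real K - real i) * (real K - real k)) * (P i k * P k i))
      = (\<Sum>i\<le>n. \<Sum>k\<le>n. (\<Sum>l<K. V i l * cnj (V k l))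
          * (\<Sum>m<K. (of_real (real K - real k) * V k m)
          * (of_real (real K - real i) * cnj (V i m))))"
      unfolding P_def by (intro sum.cong refl) (simp add: sum_distrib_left mult_ac
          del: of_real_diff)
    also have "\<dots> = (\<Sum>l<K. \<Sum>m<K. (\<Sum>i\<le>n. of_real (real K - real i) * cnj (V i m) * V i l)
        * (\<Sum>k\<le>n. cnj (V k l) * (of_real (real K - real k) * V k m)))"
      by (rule sum_product_factor)
    also have "\<dots> = (\<Sum>l<K. \<Sum>m<K. (if m = l then of_real c else 0)
        * (if l = m then of_real c else 0))"
      by (intro sum.cong refl arg_cong2[where f = "(*)"]) (simp_all add: diag[symmetric] mult_ac
          del: of_real_diff)
    also have "\<dots> = of_real (c\<^sup>2 * real K)"
      by (simp add: if_distrib power2_eq_square cong: if_cong)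
    finally show ?thesis .
  qed
  have ladder: "(\<Sum>i<n. \<Sum>k<n. of_real (sqrt (real (Suc i) * real (n - i))
      * sqrt (real (Suc k) * real (n - k))) *
        (P (Suc i) (Suc k) * P k i)) = 0"
  proof -
    define s where "s i = complex_of_real (sqrt (real (Suc i) * real (n - i)))" for i
    have "(\<Sum>i<n. \<Sum>k<n. of_real (sqrt (real (Suc i) * real (n - i))
        * sqrt (real (Suc k) * real (n - k))) * (P (Suc i) (Suc k) * P k i))
      = (\<Sum>i<n. \<Sum>k<n. (\<Sum>l<K. V (Suc i) l * (s k * cnj (V (Suc k) l)))
          * (\<Sum>m<K. V k m * (s i * cnj (V i m))))"
    proof (intro sum.cong refl)
      fix i k
      have "(\<Sum>l<K. V (Suc i) l * (s k * cnj (V (Suc k) l))) = s k * P (Suc i) (Suc k)"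
        "(\<Sum>m<K. V k m * (s i * cnj (V i m))) = s i * P k i"
        by (simp_all add: P_def sum_distrib_left mult_ac)
      then show "of_real (sqrt (real (Suc i) * real (n - i)) * sqrt (real (Suc k) * real (n - k)))
          * (P (Suc i) (Suc k) * P k i)
         = (\<Sum>l<K. V (Suc i) l * (s k * cnj (V (Suc k) l))) * (\<Sum>m<K. V k m * (s i * cnj (V i m)))"
        by (simp only: s_def of_real_mult mult_ac)
    qed
    also have "\<dots> = (\<Sum>l<K. \<Sum>m<K. (\<Sum>i<n. s i * cnj (V i m) * V (Suc i) l)
        * (\<Sum>k<n. s k * cnj (V (Suc k) l) * V k m))"
      by (rule sum_product_factor)
    also have "\<dots> = 0"
    proof -
      have "(\<Sum>k<n. s k * cnj (V (Suc k) l) * V k m) = 0" if "l < K" "m < K" for l m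
        using lower[OF that] by (simp only: s_def mult.assoc)
      then show ?thesis by simp
    qed
    finally show ?thesis .
  qed
  have "2 \<le> K" using n by auto
  show False
    by (rule no_rigid_projection[OF n idem contraction_rigid[OF n(1) \<open>2
        \<le> K\<close> herm tr sq trH sqH ladder]])
qed

section \<open>Weight bases\<close>

text \<open>The Hermitian form itself: \<open>inner\<close> on this type is its real part, while
  coordinates in a weight basis are complex.\<close>

definition cip :: "complex^'d \<Rightarrow> complex^'d \<Rightarrow> complex"
  where "cip x y = (\<Sum>i\<in>UNIV. cnj (x $ i) * y $ i)"

lemma cip_add_right: "cip x (y + z) = cip x y + cip x z"
  by (simp add: cip_def algebra_simps sum.distrib)

lemma cip_diff_right: "cip x (y - z) = cip x y - cip x z"
  by (simp add: cip_def algebra_simps sum_subtractf)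

lemma cip_smult_right: "cip x (a *s y) = a * cip x y"
  by (simp add: cip_def sum_distrib_left mult_ac)

lemma cip_smult_left: "cip (a *s x) y = cnj a * cip x y"
  by (simp add: cip_def sum_distrib_left mult_ac)

lemma cip_zero_right [simp]: "cip x 0 = 0"
  by (simp add: cip_def)

lemma cip_sum_right: "cip x (\<Sum>i\<in>I. f i) = (\<Sum>i\<in>I. cip x (f i))"
  by (induction I rule: infinite_finite_induct) (simp_all add: cip_add_right)

lemma cnj_cip: "cnj (cip x y) = cip y x"
  by (simp add: cip_def mult.commute)

lemma cip_self: "cip x x = of_real ((norm x)\<^sup>2)"
proof -
  have "cip x x = (\<Sum>i\<in>UNIV. of_real ((norm (x $ i))\<^sup>2))"
    unfolding cip_def complex_norm_square by (simp add: mult.commute)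
  then show ?thesis
    by (simp add: norm_vec_def L2_set_def real_sqrt_pow2 sum_nonneg)
qed

lemma cip_dagger: "cip (A *v x) y = cip x (dagger A *v y)"
proof -
  have "cip (A *v x) y = (\<Sum>i\<in>UNIV. \<Sum>j\<in>UNIV. cnj (A $ i $ j) * cnj (x $ j) * y $ i)"
    by (simp add: cip_def matrix_vector_mult_def sum_distrib_right)
  also have "\<dots> = (\<Sum>j\<in>UNIV. \<Sum>i\<in>UNIV. cnj (A $ i $ j) * cnj (x $ j) * y $ i)"
    by (rule sum.swap)
  also have "\<dots> = cip x (dagger A *v y)"
    by (simp add: cip_def matrix_vector_mult_def dagger_def transpose_def sum_distrib_left mult_ac)
  finally show ?thesis .
qed

lemma scaleR_eq_smult: "r *\<^sub>R x = complex_of_real r *s x" for x :: "complex^'d"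
  unfolding vec_eq_iff vector_scaleR_component vector_smult_component
      by (simp only: scaleR_conv_of_real simp_thms)

text \<open>First-order condition at a minimum: for small t of sign opposite to a, the linear term
  would dominate.\<close>

lemma quadratic_nonneg_imp_linear_zero:
  fixes a b :: real
  assumes "\<And>t. 0 \<le> 2 * t * a + t\<^sup>2 * b"
  shows "a = 0"
proof (rule ccontr)
  assume a: "a \<noteq> 0"
  define t where "t = - a / (\<bar>b\<bar> + 1)"
  have t: "t * (\<bar>b\<bar> + 1) = - a" by (simp add: t_def)
  have "t \<noteq> 0" using a t by auto
  have "2 * t * a + t\<^sup>2 * b = t\<^sup>2 * (b - 2 * (\<bar>b\<bar> + 1))"
    using t by (simp add: power2_eq_square algebra_simps) algebra
  moreover have "t\<^sup>2 * (b - 2 * (\<bar>b\<bar> + 1)) < 0"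
    using \<open>t \<noteq> 0\<close> by (intro mult_pos_neg) auto
  ultimately show False using assms[of t] by simp
qed

section \<open>Highest weight vectors and ladder operators\<close>

text \<open>The quadratic form of H attains its maximum on the compact unit sphere, at an
  eigenvector. The bound is part of the conclusion because it later shows that the raising operator
  kills this vector.\<close>

lemma hermitian_top_eigenvector:
  fixes H :: "complex^'d^'d"
  assumes herm: "dagger H = H"
  obtains v \<mu> where "v \<noteq> 0" "H *v v = \<mu> *\<^sub>R v" "\<And>x. x \<bullet> (H *v x) \<le> \<mu> * (x \<bullet> x)"
proof -
  have sym: "(H *v x) \<bullet> y = x \<bullet> (H *v y)" for x y
    using inner_dagger[of H x y] herm by simp
  have lin: "H *v (r *\<^sub>R x) = r *\<^sub>R (H *v x)" for r x
    by (simp add: scaleR_eq_smult vector_scalar_commute)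
  have cont: "continuous_on A (\<lambda>x. x \<bullet> (H *v x))" for A
    by (intro continuous_intros linear_continuous_on linear_conv_bounded_linear[THEN iffD1] linearI)
      (simp_all add: lin matrix_vector_right_distrib)
  have "sphere (0 :: complex^'d) 1 \<noteq> {}"
    using vector_choose_size[of 1] by (metis dist_0_norm empty_iff mem_sphere zero_le_one)
  then obtain v where v: "v \<in> sphere 0 1" and max: "\<And>y. y \<in> sphere 0 1 \<Longrightarrow> y \<bullet> (H *v y)
      \<le> v \<bullet> (H *v v)"
    using continuous_attains_sup[OF compact_sphere _ cont] by metis
  define \<mu> where "\<mu> = v \<bullet> (H *v v)"
  have bound: "x \<bullet> (H *v x) \<le> \<mu> * (x \<bullet> x)" for x
  proof (cases "x = 0")
    case False
    define y where "y = x /\<^sub>R norm x"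
    have "y \<in> sphere 0 1" using False by (simp add: y_def)
    from max[OF this] have "y \<bullet> (H *v y) \<le> \<mu>" by (simp add: \<mu>_def)
    moreover have "x = norm x *\<^sub>R y" using False by (simp add: y_def)
    then have "x \<bullet> (H *v x) = (norm x)\<^sup>2 * (y \<bullet> (H *v y))"
      by (metis inner_scaleR_left inner_scaleR_right lin mult.assoc power2_eq_square)
    ultimately show ?thesis
      by (simp add: power2_norm_eq_inner mult.commute[of _ "x \<bullet> x"] mult_left_mono)
  qed simp
  \<comment> \<open>The nonnegative function \<mu> (x \<bullet> x) - x \<bullet> H x vanishes at v,
    and its derivative there in the direction of the residual w is 2 (w \<bullet> w); so w =
    0.\<close>
  define w where "w = \<mu> *\<^sub>R v - H *v v"
  have vv: "v \<bullet> v = 1" using v by (simp add: norm_eq_1)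
  have "w \<bullet> w = 0"
  proof (rule quadratic_nonneg_imp_linear_zero)
    fix t
    have "v \<bullet> (H *v w) = w \<bullet> (H *v v)"
      by (metis inner_commute sym)
    then have e1: "(v + t *\<^sub>R w) \<bullet> (H *v (v + t *\<^sub>R w)) = \<mu> + 2 * t * (w \<bullet> (H *v v)) + t\<^sup>2
        * (w \<bullet> (H *v w))"
      by (simp add: matrix_vector_right_distrib lin inner_add_left inner_add_right
          power2_eq_square \<mu>_def distrib_left mult.assoc)
    have e2: "(v + t *\<^sub>R w) \<bullet> (v + t *\<^sub>R w) = 1 + 2 * t * (w \<bullet> v) + t\<^sup>2 * (w \<bullet> w)"
      by (simp add: inner_add_left inner_add_right power2_eq_square vv inner_commute[of v w]
          distrib_left mult.assoc)
    have ww: "w \<bullet> w = \<mu> * (w \<bullet> v) - w \<bullet> (H *v v)"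
      by (subst (2) w_def) (simp add: inner_diff_right)
    have "2 * t * (w \<bullet> w) = 2 * t * (\<mu> * (w \<bullet> v)) - 2 * t * (w \<bullet> (H *v v))"
      by (subst ww) (rule right_diff_distrib)
    then show "0 \<le> 2 * t * (w \<bullet> w) + t\<^sup>2 * (\<mu> * (w \<bullet> w) - w \<bullet> (H *v w))"
      using bound[of "v + t *\<^sub>R w"] unfolding e1 e2 by (simp add: algebra_simps)
  qed
  then have "H *v v = \<mu> *\<^sub>R v" by (simp add: w_def)
  moreover have "v \<noteq> 0" using vv by auto
  ultimately show thesis using bound that by blast
qed

text \<open>Highest weight argument: a top eigenvector of H is killed by E, its images under powers
  of F are eigenvectors of H with computable norms, and by irreducibility they span the space.
  Normalising with positive factors makes the matrix elements of F nonnegative square roots.\<close>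

lemma weight_basis:
  fixes H E F :: "complex^'d^'d"
  assumes H: "dagger H = H" and EF: "dagger E = F"
    and HE: "\<And>x. H *v (E *v x) = E *v (H *v x) + E *v x"
    and HF: "\<And>x. H *v (F *v x) = F *v (H *v x) - F *v x"
    and EFx: "\<And>x. E *v (F *v x) = F *v (E *v x) + 2 *s (H *v x)"
    and irr: "\<And>U. vec.subspace U \<Longrightarrow> (\<And>x. x \<in> U \<Longrightarrow> H *v x \<in> U \<and> E *v x \<in> U \<and> F *v x \<in> U) \<Longrightarrow> U
        = {0} \<or> U = UNIV"
    and card: "CARD('d) = n + 1"
  obtains e where "\<And>i k. i \<le> n \<Longrightarrow> k \<le> n \<Longrightarrow> cip (e i) (e k) = (if i = k then 1 else 0)"
    and "\<And>x. x = (\<Sum>i\<le>n. cip (e i) x *s e i)"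
    and "\<And>i. i \<le> n \<Longrightarrow> H *v e i = of_real (real n / 2 - real i) *s e i"
    and "\<And>i. i < n \<Longrightarrow> F *v e i = of_real (sqrt (real (Suc i) * real (n - i))) *s e (Suc i)"
    and "F *v e n = 0"
proof -
  obtain v \<mu> where v: "v \<noteq> 0" and Hv: "H *v v = \<mu> *\<^sub>R v" and top: "\<And>x. x \<bullet> (H *v x) \<le> \<mu> * (x \<bullet> x)"
    using hermitian_top_eigenvector[OF H] by blast
  \<comment> \<open>Otherwise \<open>E *v v\<close> would be an eigenvector of H with eigenvalue
    \<mu> + 1, above the maximum.\<close>
  have Ev: "E *v v = 0"
  proof (rule ccontr)
    assume nz: "E *v v \<noteq> 0"
    have "H *v (E *v v) = (\<mu> + 1) *\<^sub>R (E *v v)"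
      by (simp add: HE Hv scaleR_eq_smult vector_scalar_commute vector_sadd_rdistrib)
    then have "(E *v v) \<bullet> (E *v v) \<le> 0"
      using top[of "E *v v"] by (simp add: algebra_simps)
    then show False
      using nz inner_gt_zero_iff[of "E *v v"] by linarith
  qed
  define f where "f k = (((*v) F) ^^ k) v" for k
  have f0: "f 0 = v" and fS: "f (Suc k) = F *v f k" for k
    by (simp_all add: f_def)
  have Hf: "H *v f k = of_real (\<mu> - real k) *s f k" for k
  proof (induction k)
    case 0
    then show ?case by (simp add: f0 Hv scaleR_eq_smult)
  next
    case (Suc k)
    have "H *v f (Suc k) = of_real (\<mu> - real k) *s f (Suc k) - 1 *s f (Suc k)"
      by (simp only: fS HF Suc vector_scalar_commute vector_smult_lid)
    also have "\<dots> = (of_real (\<mu> - real k) - 1) *s f (Suc k)"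
      by (rule vec.scale_left_diff_distrib[symmetric])
    also have "of_real (\<mu> - real k) - 1 = complex_of_real (\<mu> - real (Suc k))"
      by simp
    finally show ?case .
  qed
  have Ef: "E *v f (Suc k) = of_real (real (Suc k) * (2 * \<mu> - real k)) *s f k" for k
  proof (induction k)
    case 0
    then show ?case
      by (simp add: fS EFx f0 Ev Hv scaleR_eq_smult)
  next
    case (Suc k)
    have "E *v f (Suc (Suc k)) = F *v (E *v f (Suc k)) + 2 *s (H *v f (Suc k))"
      by (simp only: fS EFx)
    also have "\<dots> = of_real (real (Suc k) * (2 * \<mu> - real k)) *s f (Suc k)
        + 2 *s (of_real (\<mu> - real (Suc k)) *s f (Suc k))"
      by (simp only: Suc Hf vector_scalar_commute fS[symmetric])
    also have "\<dots> = of_real (real (Suc k) * (2 * \<mu> - real k) + 2 * (\<mu> - real (Suc k))) *s f (Suc k)"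
      by (simp only: vector_smult_assoc vector_sadd_rdistrib of_real_add of_real_mult
          of_real_numeral)
    also have "real (Suc k) * (2 * \<mu> - real k) + 2 * (\<mu> - real (Suc k)) = real (Suc (Suc k))
        * (2 * \<mu> - real (Suc k))"
      by (simp add: algebra_simps)
    finally show ?case .
  qed
  have norm_f: "(norm (f (Suc k)))\<^sup>2 = real (Suc k) * (2 * \<mu> - real k) * (norm (f k))\<^sup>2" for k
  proof -
    have "cip (f (Suc k)) (f (Suc k)) = cip (E *v f (Suc k)) (f k)"
      by (simp add: cip_dagger EF fS)
    then have "complex_of_real ((norm (f (Suc k)))\<^sup>2)
        = of_real (real (Suc k) * (2 * \<mu> - real k) * (norm (f k))\<^sup>2)"
      unfolding Ef cip_smult_left cip_self by simp
    then show ?thesis by (simp only: of_real_eq_iff)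
  qed
  \<comment> \<open>The factor 2 \<mu> - k in \<open>norm_f\<close> becomes negative for large k, so
    the string must end.\<close>
  have "\<exists>k. f k = 0"
  proof (rule ccontr)
    assume "\<nexists>k. f k = 0"
    then have nz: "f k \<noteq> 0" for k by blast
    obtain k where k: "2 * \<mu> < real k" using reals_Archimedean2 by blast
    have "0 < (norm (f (Suc k)))\<^sup>2" using nz by simp
    then show False
      using k unfolding norm_f by (simp add: zero_less_mult_iff mult_less_0_iff)
  qed
  then have least: "f (LEAST k. f k = 0) = 0"
    by (rule LeastI_ex)
  then obtain m where m: "(LEAST k. f k = 0) = Suc m"
    using v f0 by (metis not0_implies_Suc)
  have m0: "f (Suc m) = 0"
    using least unfolding m .
  have fnz: "f k \<noteq> 0" if "k \<le> m" for k
    using not_less_Least[of k "\<lambda>k. f k = 0"] that unfolding m by simp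
  \<comment> \<open>At the last nonzero vector the factor 2 \<mu> - m in \<open>norm_f\<close> has
    to be zero.\<close>
  have \<mu>: "2 * \<mu> = real m"
    using norm_f[of m] m0 fnz[of m] by simp
  define e where "e k = of_real (1 / norm (f k)) *s f k" for k
  have He: "H *v e k = of_real (real m / 2 - real k) *s e k" for k
  proof -
    have "real m / 2 = \<mu>" using \<mu> by simp
    then show ?thesis
      by (simp only: e_def vector_scalar_commute Hf vector_smult_assoc mult.commute)
  qed
  have Fe: "F *v e k = of_real (sqrt (real (Suc k) * real (m - k))) *s e (Suc k)" if "k < m" for k
  proof -
    have "(norm (f (Suc k)))\<^sup>2 = real (Suc k) * real (m - k) * (norm (f k))\<^sup>2"
      using norm_f[of k] \<mu> that by (simp add: of_nat_diff)
    then have "norm (f (Suc k)) = sqrt (real (Suc k) * real (m - k)) * norm (f k)"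
      by (metis norm_ge_zero real_sqrt_mult real_sqrt_unique real_sqrt_abs abs_norm_cancel)
    moreover have "norm (f (Suc k)) \<noteq> 0" "norm (f k) \<noteq> 0" using fnz that by auto
    ultimately have "1 / norm (f k) = sqrt (real (Suc k) * real (m - k)) * (1 / norm (f (Suc k)))"
      by (simp add: field_simps)
    then show ?thesis
      by (simp only: e_def vector_scalar_commute vector_smult_assoc of_real_mult[symmetric]
          fS[symmetric])
  qed
  have Fe0: "F *v e m = 0"
    using m0 by (simp add: e_def vector_scalar_commute fS[symmetric])
  have Ee: "E *v e (Suc k) = of_real (norm (f k) / norm (f (Suc k))
      * (real (Suc k) * (2 * \<mu> - real k))) *s e k" if "k < m" for k
    using fnz[of k] that by (simp add: e_def vector_scalar_commute Ef vector_smult_assoc)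
  have Ee0: "E *v e 0 = 0"
    by (simp add: e_def f0 Ev vector_scalar_commute)
  have orth: "cip (e i) (e k) = (if i = k then 1 else 0)" if "i \<le> m" "k \<le> m" for i k
  proof (cases "i = k")
    case True
    then show ?thesis
      using fnz[OF that(2)] unfolding True e_def cip_smult_left cip_smult_right unfolding cip_self
      by (simp add: power2_eq_square)
  next
    case False
    have "cip (H *v e i) (e k) = cip (e i) (H *v e k)"
      by (simp add: cip_dagger H)
    then have "complex_of_real (real k - real i) * cip (e i) (e k) = 0"
      unfolding He cip_smult_left cip_smult_right by (simp add: algebra_simps)
    then show ?thesis using False by simp
  qed
  \<comment> \<open>\<open>L\<close> projects orthogonally onto the span of the \<open>e i\<close>.
    Its fixed space \<open>U\<close> is invariant, hence everything by irreducibility, and this is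
    the expansion.\<close>
  define L where "L x = (\<Sum>i\<le>m. cip (e i) x *s e i)" for x
  define U where "U = {x. L x = x}"
  have L_add: "L (x + y) = L x + L y" for x y
    by (simp add: L_def cip_add_right vector_sadd_rdistrib sum.distrib)
  have L_smult: "L (a *s x) = a *s L x" for a x
    by (simp add: L_def cip_smult_right vec.scale_sum_right)
  have sub: "vec.subspace U"
    unfolding vec.subspace_def U_def by (auto simp: L_add L_smult) (simp add: L_def)
  have eU: "e k \<in> U" if "k \<le> m" for k
  proof -
    have "L (e k) = (\<Sum>i\<le>m. if i = k then e k else 0)"
      unfolding L_def using that by (intro sum.cong refl) (simp add: orth)
    then show ?thesis using that by (simp add: U_def)
  qed
  have closed: "A *v x \<in> U" if A: "\<And>k. k \<le> m \<Longrightarrow> A *v e k \<in> U" and x: "x \<in> U" for A x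
  proof -
    have "A *v L x = (\<Sum>i\<le>m. cip (e i) x *s (A *v e i))"
      unfolding L_def by (induction m)
          (simp_all add: matrix_vector_right_distrib vector_scalar_commute)
    moreover have "L x = x" using x by (simp add: U_def)
    ultimately have "A *v x = (\<Sum>i\<le>m. cip (e i) x *s (A *v e i))" by simp
    then show ?thesis
      using A sub by (auto intro!: vec.subspace_sum vec.subspace_scale)
  qed
  have "H *v e k \<in> U" "E *v e k \<in> U" "F *v e k \<in> U" if k: "k \<le> m" for k
  proof -
    show "H *v e k \<in> U"
      unfolding He using sub eU[OF k] by (rule vec.subspace_scale)
    show "E *v e k \<in> U"
      using k Ee[of "k - 1"] Ee0 eU[of "k - 1"] sub
      by (cases k) (simp_all add: vec.subspace_scale vec.subspace_0)
    show "F *v e k \<in> U"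
      using k Fe[of k] Fe0 eU[of "Suc k"] sub
      by (cases "k = m") (simp_all add: vec.subspace_scale vec.subspace_0)
  qed
  then have "U = {0} \<or> U = UNIV"
    using closed by (intro irr[OF sub]) blast
  moreover have "e 0 \<noteq> 0"
    using orth[of 0 0] by (auto simp: cip_def)
  ultimately have "U = UNIV" using eU[of 0] by auto
  then have expand: "x = (\<Sum>i\<le>m. cip (e i) x *s e i)" for x
    unfolding L_def[symmetric] by (simp add: U_def set_eq_iff)
  \<comment> \<open>The trace of the identity, computed in the standard basis and in the basis
    \<open>e\<close>, gives \<open>CARD('d) = m + 1\<close>.\<close>
  have "m = n"
  proof -
    have "(1 :: complex) = (\<Sum>i\<le>m. cnj (e i $ j) * e i $ j)" for j
    proof -
      have "axis j 1 $ j = (\<Sum>i\<le>m. cip (e i) (axis j 1) *s e i) $ j"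
        using expand by simp
      then show ?thesis
        by (simp add: cip_def axis_def if_distrib cong: if_cong)
    qed
    then have "(\<Sum>j\<in>(UNIV :: 'd set). (1 :: complex)) = (\<Sum>j\<in>UNIV. \<Sum>i\<le>m. cnj (e i $ j) * e i $ j)"
      by (intro sum.cong refl)
    also have "\<dots> = (\<Sum>i\<le>m. cip (e i) (e i))"
      unfolding cip_def by (rule sum.swap)
    also have "\<dots> = of_nat (m + 1)"
      by (simp add: orth)
    finally have "complex_of_nat (CARD('d)) = of_nat (m + 1)" by simp
    then show ?thesis
      using card by (simp only: of_nat_eq_iff)
  qed
  then show thesis
    using that[of e] orth expand He Fe Fe0 by blast
qed

section \<open>Codes of distance two\<close>

unbundle cross3_syntax

text \<open>\<open>- (\<i> / 2) v \<cdot> \<sigma>\<close> for the vector \<open>\<sigma>\<close> of Pauli matrices.\<close>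

definition spin_vec :: "real^3 \<Rightarrow> complex^2^2"
  where "spin_vec v = vector [vector [Complex 0 (- v$3 / 2), Complex (- v$2 / 2) (- v$1 / 2)],
    vector [Complex (v$2 / 2) (- v$1 / 2), Complex 0 (v$3 / 2)]]"

lemma spin_vec_in_su2: "spin_vec v \<in> su2"
  by (simp add: su2_def spin_vec_def dagger_def transpose_def trace_def vec_eq_iff forall_2 sum_2
      complex_eq_iff)

lemma spin_vec_add: "spin_vec (v + w) = spin_vec v + spin_vec w"
  by (simp add: spin_vec_def vec_eq_iff forall_2 complex_eq_iff field_simps)

lemma spin_vec_scaleR: "spin_vec (r *\<^sub>R v) = r *\<^sub>R spin_vec v"
  by (simp add: spin_vec_def vec_eq_iff forall_2 complex_eq_iff)

text \<open>The factor 1 / 2 in \<open>spin_vec\<close> makes the bracket exactly the cross product,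
  so rotations of R^3 preserve the commutation relations.\<close>

lemma commutator_spin_vec: "commutator (spin_vec v) (spin_vec w) = spin_vec (v \<times> w)"
  by (simp add: commutator_def spin_vec_def matrix_matrix_mult_def vec_eq_iff forall_2 sum_2
      complex_eq_iff
      cross3_def field_simps)

lemma su2_eq_spin_vec:
  assumes "X \<in> su2"
  shows "\<exists>v. X = spin_vec v"
proof -
  have skew: "cnj (X $ j $ i) = - X $ i $ j" for i j
    using assms by (auto simp: su2_def dagger_def transpose_def vec_eq_iff)
  have "X $ 1 $ 1 + X $ 2 $ 2 = 0"
    using assms by (simp add: su2_def trace_def sum_2)
  then have "X = spin_vec (vector [- 2 * Im (X $ 1 $ 2), - 2 * Re (X $ 1 $ 2), - 2
      * Im (X $ 1 $ 1)])"
    using skew[of 1 1] skew[of 1 2] skew[of 2 2]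
    by (simp add: spin_vec_def vec_eq_iff forall_2 complex_eq_iff)
  then show ?thesis ..
qed

section \<open>Orthonormal code vectors and adapted spin frames\<close>

text \<open>Each induction step is a Gram-Schmidt step; a new vector exists because K vectors cannot
  span a space of larger dimension.\<close>

lemma orthonormal_family_exists:
  fixes C :: "(complex^'d) set"
  assumes C: "vec.subspace C" and "K \<le> vec.dim C"
  shows "\<exists>v. (\<forall>l<K. v l \<in> C) \<and> (\<forall>l<K. \<forall>m<K. cip (v l) (v m) = (if l = m then 1 else 0))"
  using assms(2)
proof (induction K)
  case (Suc K)
  then obtain v where v: "\<And>l. l < K \<Longrightarrow> v l \<in> C"
    and orth: "\<And>l m. l < K \<Longrightarrow> m < K \<Longrightarrow> cip (v l) (v m) = (if l = m then 1 else 0)"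
    by auto
  have "\<not> C \<subseteq> vec.span (v ` {..<K})"
  proof
    assume "C \<subseteq> vec.span (v ` {..<K})"
    then have "vec.dim C \<le> card (v ` {..<K})"
      by (rule vec.dim_le_card) simp
    also have "\<dots> \<le> K"
      using card_image_le[of "{..<K}" v] by simp
    finally show False using Suc.prems by simp
  qed
  then obtain x where x: "x \<in> C" "x \<notin> vec.span (v ` {..<K})" by blast
  define p where "p = (\<Sum>l<K. cip (v l) x *s v l)"
  define y where "y = x - p"
  have "p \<in> vec.span (v ` {..<K})"
    unfolding p_def by (intro vec.span_sum vec.span_scale vec.span_base) auto
  then have "y \<noteq> 0" using x by (auto simp: y_def)
  have "p \<in> C"
    unfolding p_def using C v by (intro vec.subspace_sum vec.subspace_scale) auto
  then have yC: "y \<in> C"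
    unfolding y_def using C x by (intro vec.subspace_diff)
  have vy: "cip (v l) y = 0" if "l < K" for l
  proof -
    have "cip (v l) p = (\<Sum>m<K. cip (v m) x * (if l = m then 1 else 0))"
      unfolding p_def cip_sum_right cip_smult_right using that
          by (intro sum.cong refl) (simp add: orth)
    then have "cip (v l) p = cip (v l) x"
      using that by (simp add: if_distrib[of "(*) _"] cong: if_cong)
    moreover have "cip (v l) x = cip (v l) y + cip (v l) p"
      by (simp add: y_def flip: cip_add_right)
    ultimately show ?thesis by simp
  qed
  then have yv: "cip y (v l) = 0" if "l < K" for l
    using that by (metis cnj_cip complex_cnj_zero)
  define z where "z = of_real (1 / norm y) *s y"
  have zz: "cip z z = 1"
    using \<open>y \<noteq> 0\<close> unfolding z_def cip_smult_left cip_smult_right unfolding cip_self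
    by (simp add: power2_eq_square)
  have "z \<in> C"
    unfolding z_def using C yC by (rule vec.subspace_scale)
  then have "(\<forall>l<Suc K. (v(K := z)) l \<in> C) \<and>
      (\<forall>l<Suc K. \<forall>m<Suc K. cip ((v(K := z)) l) ((v(K := z)) m) = (if l = m then 1 else 0))"
    using v orth zz vy yv by (auto simp: less_Suc_eq z_def cip_smult_left cip_smult_right)
  then show ?case by blast
qed auto

text \<open>On a code the spin expectation is a functional u -> w \<bullet> u. A rotation that
  carries the third axis to the direction of w makes the expectations along the other two axes
  vanish, and determinant 1 preserves cross products.\<close>

lemma rotated_frame:
  fixes w :: "real^3"
  obtains R :: "real^3 \<Rightarrow> real^3" where "linear R" "surj R"
    and "w \<bullet> R (axis 1 1) = 0" "w \<bullet> R (axis 2 1) = 0"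
    and "R (axis 1 1) \<times> R (axis 2 1) = R (axis 3 1)"
    and "R (axis 2 1) \<times> R (axis 3 1) = R (axis 1 1)"
    and "R (axis 3 1) \<times> R (axis 1 1) = R (axis 2 1)"
proof -
  obtain R where R: "orthogonal_transformation R" "det (matrix R) = 1" "R (norm w *\<^sub>R axis 3 1) = w"
    using rotation_rightward_line[of w 3] by auto
  have inner: "R x \<bullet> R y = x \<bullet> y" for x y
    using R(1) by (simp add: orthogonal_transformation_def)
  have cross: "R x \<times> R y = R (x \<times> y)" for x y
    using cross_orthogonal_transformation[OF R(1), of x y] R(2) by simp
  show thesis
  proof (rule that[of R])
    show "linear R" "surj R"
      using R(1) by (simp_all add: orthogonal_transformation_linear orthogonal_transformation_surj)
    have "w \<bullet> R x = norm w * (axis 3 1 \<bullet> x)" for x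
      using inner[of "norm w *\<^sub>R axis 3 1" x] R(3) by simp
    then show "w \<bullet> R (axis 1 1) = 0" "w \<bullet> R (axis 2 1) = 0"
      by (simp_all add: inner_axis_axis)
  qed (simp_all add: cross cross_basis)
qed

lemma mat_scale_mult_vec: "mat_scale c A *v x = c *s (A *v x)"
  by (simp add: mat_scale_def vec_eq_iff matrix_vector_mult_def sum_distrib_left mult.assoc)

lemma scaleR_mult_vec: "(r *\<^sub>R A) *v x = complex_of_real r *s (A *v x)" for A :: "complex^'a^'b"
  unfolding vec_eq_iff matrix_vector_mult_def vec_lambda_beta vector_scaleR_component
    vector_smult_component sum_distrib_left
  by (simp add: scaleR_conv_of_real mult.assoc)

lemma dagger_mat_scale: "dagger (mat_scale c A) = mat_scale (cnj c) (dagger A)"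
  by (simp add: dagger_def mat_scale_def vec_eq_iff transpose_def)

lemma dagger_add: "dagger (A + B) = dagger A + dagger B"
  by (simp add: dagger_def vec_eq_iff transpose_def)

lemma range_in_su2_metric:
  assumes "X \<in> su2"
  shows "\<phi> X \<in> su2_metric \<phi> (real 2 - 1)"
proof -
  have "\<phi> X \<in> su2_error_space \<phi>"
    unfolding su2_error_space_def using assms by (intro mat_vs.span_base) auto
  then have "foldr (**) [\<phi> X] (mat 1) \<in> op_power (su2_error_space \<phi>) 1"
    unfolding op_power_def by (intro mat_vs.span_base CollectI exI[of _ "[\<phi> X]"]) simp
  then show ?thesis
    by (simp add: su2_metric_def)
qed


section \<open>Reduction of a code to an isometry in a weight basis\<close>

theorem lemma3p5p5:
  fixes n :: nat
    and \<phi> :: "complex^2^2 \<Rightarrow> complex^'d^'d"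
    and C :: "(complex^'d) set"
  assumes "even n" and "8 \<le> n" and "n \<le> 20"
    and "CARD('d) = n + 1"
    and "unitary_su2_rep \<phi>" and "irreducible_su2_rep \<phi>"
    and "vec.subspace C"
    and "code_distance (su2_metric \<phi>) C 2"
  shows "real (vec.dim C) \<le> real n / 2 - 1"
proof (rule ccontr)
  assume large: "\<not> ?thesis"
  obtain K where n: "n = 2 * K" using \<open>even n\<close> by (rule evenE)
  have K: "0 < K" using n \<open>8 \<le> n\<close> by simp
  have n_cases: "n \<in> {8, 10, 12, 14, 16, 18, 20}"
  proof -
    have "K \<in> {4..10}" using n assms(2,3) by auto
    then have "K \<in> {4, 5, 6, 7, 8, 9, 10}" by auto
    then show ?thesis unfolding n by auto
  qed
  \<comment> \<open>The negated bound reads dim C > K - 1; K orthonormal vectors of C suffice for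
    the contradiction.\<close>
  have "K \<le> vec.dim C"
    using large n by linarith
  then obtain v where vC: "\<And>l. l < K \<Longrightarrow> v l \<in> C"
    and v_orth: "\<And>l m. l < K \<Longrightarrow> m < K \<Longrightarrow> cip (v l) (v m) = (if l = m then 1 else 0)"
    using orthonormal_family_exists[OF assms(7)] by metis
  define P where "P = orth_proj C"
  have P: "P ** P = P" "dagger P = P" "range ((*v) P) = C"
    using orth_proj[OF assms(7)] by (auto simp: P_def is_orth_proj_def)
  have P_id: "P *v x = x" if "x \<in> C" for x
  proof -
    from that have "x \<in> range ((*v) P)" by (simp only: P(3))
    then obtain y where "x = P *v y" by blast
    then show ?thesis by (simp add: matrix_vector_mul_assoc P(1))
  qed

  have add: "\<phi> (X + Y) = \<phi> X + \<phi> Y" and comm: "\<phi> (commutator X Y) = commutator (\<phi> X) (\<phi> Y)"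
    if "X \<in> su2" "Y \<in> su2" for X Y
    using assms(5) that by (auto simp: unitary_su2_rep_def su2_rep_def)
  have scale: "\<phi> (r *\<^sub>R X) = r *\<^sub>R \<phi> X" and skew: "dagger (\<phi> X) = - \<phi> X" if "X \<in> su2" for X r
    using assms(5) that by (auto simp: unitary_su2_rep_def su2_rep_def)
  \<comment> \<open>The factor \<i> makes the operators Hermitian and turns the bracket into
    [J u, J u'] = \<i> J (u \<times> u').\<close>
  define J where "J u = mat_scale \<i> (\<phi> (spin_vec u))" for u
  have J_vec: "J u *v x = \<i> *s (\<phi> (spin_vec u) *v x)" for u x
    by (simp add: J_def mat_scale_mult_vec)
  have J_add: "J (u + u') *v x = J u *v x + J u' *v x" for u u' x
    by (simp add: J_vec spin_vec_add add spin_vec_in_su2 matrix_vector_mult_add_rdistrib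
        vec.scale_right_distrib)
  have J_scale: "J (r *\<^sub>R u) *v x = of_real r *s (J u *v x)" for r u x
    by (simp add: J_vec spin_vec_scaleR scale spin_vec_in_su2 scaleR_mult_vec vector_smult_assoc
        mult.commute)
  have J_dagger: "dagger (J u) = J u" for u
    by (simp add: J_def dagger_mat_scale skew spin_vec_in_su2)
  have J_comm: "J u *v (J u' *v x) = J u' *v (J u *v x) + \<i> *s (J (u \<times> u') *v x)" for u u' x
  proof -
    have "\<phi> (spin_vec (u \<times> u')) *v x
        = \<phi> (spin_vec u) *v (\<phi> (spin_vec u') *v x) - \<phi> (spin_vec u') *v (\<phi> (spin_vec u) *v x)"
      by (simp add: commutator_spin_vec[symmetric] comm spin_vec_in_su2)
        (simp add: commutator_def matrix_vector_mult_diff_rdistrib matrix_vector_mul_assoc)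
    then show ?thesis
      by (simp add: J_vec vector_scalar_commute vector_smult_assoc vec.scale_right_diff_distrib)
  qed

  \<comment> \<open>Detection makes the compression of \<open>J u\<close> to the code a scalar, so a
    single code vector determines it.\<close>
  define g where "g u = cip (v 0) (J u *v v 0)" for u
  have detect: "cip (v l) (J u *v v m) = (if l = m then g u else 0)" if "l < K" "m < K" for l m u
  proof -
    have "\<phi> (spin_vec u) \<in> su2_metric \<phi> (real 2 - 1)"
      by (rule range_in_su2_metric[OF spin_vec_in_su2])
    then have "detects C (\<phi> (spin_vec u))"
      using assms(8) by (auto simp: code_distance_def detects_up_to_def)
    then obtain c where c: "P ** \<phi> (spin_vec u) ** P = mat_scale c P"
      by (auto simp: detects_def P_def)
    have "cip (v l) (J u *v v m) = \<i> * c * cip (v l) (v m)" if "l < K" "m < K" for l m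
    proof -
      have "cip (v l) (\<phi> (spin_vec u) *v v m) = cip (P *v v l) (\<phi> (spin_vec u) *v (P *v v m))"
        using that by (simp add: P_id vC)
      also have "\<dots> = cip (v l) ((P ** \<phi> (spin_vec u) ** P) *v v m)"
        by (simp add: cip_dagger P(2) matrix_vector_mul_assoc matrix_mul_assoc)
      also have "\<dots> = c * cip (v l) (v m)"
        using that by (simp add: c mat_scale_mult_vec P_id vC cip_smult_right)
      finally show ?thesis
        by (simp add: J_vec cip_smult_right)
    qed
    from this[OF that] this[OF K K] show ?thesis
      using that K by (simp add: g_def v_orth)
  qed
  have g_real: "g u = of_real (Re (g u))" for u
  proof -
    have "cnj (g u) = g u"
      unfolding g_def cnj_cip by (simp add: cip_dagger J_dagger)
    then show ?thesis
      by (simp add: complex_eq_iff)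
  qed
  have g_lin: "linear (\<lambda>u. Re (g u))"
    by (rule linearI) (simp_all add: g_def J_add J_scale cip_add_right cip_smult_right)
  \<comment> \<open>Riesz representation: the adjoint of a functional takes 1 to its representing
    vector.\<close>
  define w where "w = adjoint (\<lambda>u. Re (g u)) 1"
  have gw: "g u = of_real (w \<bullet> u)" for u
    using adjoint_works[OF g_lin, of u 1] g_real[of u] by (simp add: w_def inner_commute)
  obtain R :: "real^3 \<Rightarrow> real^3" where R: "linear R" "surj R"
    "w \<bullet> R (axis 1 1) = 0" "w \<bullet> R (axis 2 1) = 0"
    "R (axis 1 1) \<times> R (axis 2 1) = R (axis 3 1)"
    "R (axis 2 1) \<times> R (axis 3 1) = R (axis 1 1)"
    "R (axis 3 1) \<times> R (axis 1 1) = R (axis 2 1)"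
    by (rule rotated_frame)
  define u1 u2 u3 where u: "u1 = R (axis 1 1)" "u2 = R (axis 2 1)" "u3 = R (axis 3 1)"
  note cr = R(5-7)[folded u]
  define H where "H = J u3"
  define E where "E = J u1 + mat_scale \<i> (J u2)"
  define F where "F = J u1 + mat_scale (- \<i>) (J u2)"
  have E_vec: "E *v x = J u1 *v x + \<i> *s (J u2 *v x)" and F_vec: "F *v x = J u1 *v x
      - \<i> *s (J u2 *v x)" for x
    by (simp_all add: E_def F_def matrix_vector_mult_add_rdistrib matrix_vector_mult_diff_rdistrib
        mat_scale_mult_vec)
  have J31: "J u3 *v (J u1 *v x) = J u1 *v (J u3 *v x) + \<i> *s (J u2 *v x)" for x
    using J_comm[of u3 u1 x] cr by simp
  have J32: "J u3 *v (J u2 *v x) = J u2 *v (J u3 *v x) - \<i> *s (J u1 *v x)" for x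
    using J_comm[of u2 u3 x] cr by (simp add: algebra_simps)
  have J12: "J u1 *v (J u2 *v x) = J u2 *v (J u1 *v x) + \<i> *s (J u3 *v x)" for x
    using J_comm[of u1 u2 x] cr by simp
  note vsimps = matrix_vector_right_distrib matrix_vector_mult_diff_distrib vector_scalar_commute
    vector_smult_assoc vec.scale_right_distrib vec.scale_right_diff_distrib

  obtain e where e_orth: "\<And>i k. i \<le> n \<Longrightarrow> k \<le> n \<Longrightarrow> cip (e i) (e k) = (if i = k then 1 else 0)"
    and expand: "\<And>x. x = (\<Sum>i\<le>n. cip (e i) x *s e i)"
    and He: "\<And>i. i \<le> n \<Longrightarrow> H *v e i = of_real (real n / 2 - real i) *s e i"
    and Fe: "\<And>i. i < n \<Longrightarrow> F *v e i = of_real (sqrt (real (Suc i) * real (n - i))) *s e (Suc i)"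
    and Fen: "F *v e n = 0"
  proof (rule weight_basis[of H E F n])
    show "dagger H = H" by (simp add: H_def J_dagger)
    show "dagger E = F" by (simp add: E_def F_def J_dagger dagger_add dagger_mat_scale)
    show "H *v (E *v x) = E *v (H *v x) + E *v x" for x
      by (simp add: H_def E_vec vsimps J31 J32)
    show "H *v (F *v x) = F *v (H *v x) - F *v x" for x
      by (simp add: H_def F_vec vsimps J31 J32)
    show "E *v (F *v x) = F *v (E *v x) + 2 *s (H *v x)" for x
    proof -
      have "2 *s y = y + y" for y :: "complex^'d"
        by (simp add: vec_eq_iff)
      then show ?thesis
        by (simp add: H_def E_vec F_vec vsimps J12)
    qed
    show "CARD('d) = n + 1" by fact
  next
    \<comment> \<open>Irreducibility passes from \<phi> to H, E, F: R is surjective, so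
      \<open>u1\<close>, \<open>u2\<close>, \<open>u3\<close> span R^3, and \<open>J u1\<close>,
      \<open>J u2\<close> are combinations of E and F.\<close>
    fix U assume U: "vec.subspace U"
      and closed: "\<And>x. x \<in> U \<Longrightarrow> H *v x \<in> U \<and> E *v x \<in> U \<and> F *v x \<in> U"
    have "\<phi> X *v x \<in> U" if X: "X \<in> su2" and x: "x \<in> U" for X x
    proof -
      obtain y where y: "X = spin_vec (R y)"
        using su2_eq_spin_vec[OF X] R(2) by (metis surjD)
      have "y = y $ 1 *\<^sub>R axis 1 1 + y $ 2 *\<^sub>R axis 2 1 + y $ 3 *\<^sub>R axis 3 1"
        by (simp add: vec_eq_iff forall_3 axis_def)
      from arg_cong[OF this, of R] have "R y = y $ 1 *\<^sub>R u1 + y $ 2 *\<^sub>R u2 + y $ 3 *\<^sub>R u3"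
        unfolding u linear_add[OF R(1)] linear_scale[OF R(1)] .
      then have "J (R y) *v x = of_real (y $ 1) *s (J u1 *v x) + of_real (y $ 2) *s (J u2 *v x)
          + of_real (y $ 3) *s (J u3 *v x)"
        by (simp add: J_add J_scale)
      moreover have "J u1 *v x = (1 / 2) *s (E *v x + F *v x)" "J u2 *v x
          = (- \<i> / 2) *s (E *v x - F *v x)"
        by (simp_all add: E_vec F_vec vec_eq_iff)
      ultimately have "J (R y) *v x \<in> U"
        using U closed[OF x] unfolding H_def
        by (simp add: vec.subspace_add vec.subspace_diff vec.subspace_scale)
      then have "(- \<i>) *s (J (R y) *v x) \<in> U"
        using U by (intro vec.subspace_scale)
      then show ?thesis
        by (simp add: J_vec y vector_smult_assoc)
    qed
    then show "U = {0} \<or> U = UNIV"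
      using assms(6) U unfolding irreducible_su2_rep_def by blast
  qed blast

  define V where "V i l = cip (e i) (v l)" for i l
  have cnjV: "cnj (V i l) = cip (v l) (e i)" for i l
    by (simp add: V_def cnj_cip)
  have apply_sum: "A *v (\<Sum>i\<le>n. f i *s e i) = (\<Sum>i\<le>n. f i *s (A *v e i))" for A f
    by (induction n) (simp_all add: matrix_vector_right_distrib vector_scalar_commute)
  have matrix_elem: "cip x (A *v v m) = (\<Sum>i\<le>n. V i m * cip x (A *v e i))" for x A m
  proof -
    have "A *v v m = A *v (\<Sum>i\<le>n. V i m *s e i)"
      unfolding V_def using expand[of "v m"] by simp
    then show ?thesis
      by (simp add: apply_sum cip_sum_right cip_smult_right)
  qed
  show False
  proof (rule no_isometry[OF n n_cases])
    fix l m assume lm: "l < K" "m < K"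
    show "(\<Sum>i\<le>n. cnj (V i l) * V i m) = (if l = m then 1 else 0)"
      using matrix_elem[of "v l" "mat 1" m] lm by (simp add: v_orth cnjV mult.commute)
    \<comment> \<open>w is orthogonal to \<open>u1\<close> and \<open>u2\<close>, so both spin
      components in \<open>F\<close> compress to zero.\<close>
    have "cip (v l) (F *v v m) = 0"
      using lm by (simp add: F_vec detect gw u R(3,4) cip_diff_right cip_smult_right)
    moreover have "cip (v l) (F *v v m) = (\<Sum>i<n. V i m * cip (v l) (F *v e i))"
      unfolding matrix_elem by (simp add: Fen flip: lessThan_Suc_atMost)
    ultimately show "(\<Sum>i<n. of_real (sqrt (real (Suc i) * real (n - i)))
        * (cnj (V (Suc i) l) * V i m)) = 0"
      by (simp add: Fe cip_smult_right cnjV mult_ac)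
    have "cip (v l) (H *v v m) = (\<Sum>i\<le>n. of_real (real K - real i) * (cnj (V i l) * V i m))"
      unfolding matrix_elem
    proof (intro sum.cong refl)
      fix i assume "i \<in> {..n}"
      then have "H *v e i = of_real (real K - real i) *s e i"
        using He[of i] unfolding n by simp
      then show "V i m * cip (v l) (H *v e i) = of_real (real K - real i) * (cnj (V i l) * V i m)"
        by (simp only: cip_smult_right cnjV mult_ac)
    qed
    then show "(\<Sum>i\<le>n. of_real (real K - real i) * (cnj (V i l) * V i m))
        = (if l = m then of_real (w \<bullet> u3) else 0)"
      unfolding H_def detect[OF lm] gw by (rule sym)
  qed
qed

end
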